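(* Let $X_0,X_1,\dots,X_n$ be real vector fields on a bounded domain $\Omega\subset\mathbb{R}^p$ satisfying assumptions (B) for some integer $r\ge2$. For any fixed $x_0\in\Omega$, let $\eta$ be a set of $p$ multiindices $I$ with $|I|\le r$ such that $\{(X_{[I]})_{x_0}\}_{I\in\eta}$ is a basis of $\mathbb{R}^p$. Then there exists a neighborhood $U$ of $x_0$ such that for any $x\in U$ and any $I\in\eta$ $$C_{\ell(I)}(t,X_I)(x)=x+t^{|I|}(X_{[I]})_x+o(t^{|I|})\quad\text{as }t\to0,$$ $$C_{\ell(I)}(t,X_I)^{-1}(x)=x-t^{|I|}(X_{[I]})_x+o(t^{|I|})\quad\text{as }t\to0,$$ where the remainder $o(t^{|I|})$ denotes a map $x\mapsto f(t)(x)$ such that $\sup_{x\in\overline U}\frac{|f(t)(x)|}{t^{|I|}}\to0$ as $t\to0$.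
   Context: Weights: $p_0=2$ and $p_i=1$ for $i=1,\dots,n$. For a multiindex $I=(i_1,\dots,i_k)$ with entries in $\{0,1,\dots,n\}$, the weight is $|I|=\sum_{j=1}^k p_{i_j}$, the length is $\ell(I)=k$, $X_I=X_{i_1}X_{i_2}\cdots X_{i_k}$, and $X_{[I]}=[X_{i_1},[X_{i_2},\dots[X_{i_{k-1}},X_{i_k}]\dots]]$ (with $X_{[I]}=X_{i_1}$ if $I=(i_1)$), where $[X,Y]=XY-YX$. $(X_{[I]})_x$ denotes $X_{[I]}$ evaluated at $x$. Assumptions (B), for an integer $r\ge2$: the coefficients of $X_1,\dots,X_n$ belong to $C^{r-1}(\overline\Omega)$; the coefficients of $X_0$ belong to $C^{r-2}(\overline\Omega)$ and, in the case $r=2$, are moreover Lipschitz continuous; the vectors $\{(X_{[I]})_x\}_{|I|\le r}$ span $\mathbb{R}^p$ at every $x\in\Omega$. Exponential: $\exp(tX)(x_0)=\varphi(t)$ where $\varphi'(\tau)=X_{\varphi(\tau)}$, $\varphi(0)=x_0$ (defined for $|t|$ small). Quasiexponential maps (products are compositions of maps, the rightmost being applied first; defined for $t$ small): $C_1(t,X_{i_1})=\exp(t^{p_{i_1}}X_{i_1})$ and, for $l\ge2$, $$C_l(t,X_{i_1}X_{i_2}\cdots X_{i_l})=C_{l-1}(t,X_{i_2}\cdots X_{i_l})^{-1}\exp(-t^{p_{i_1}}X_{i_1})\,C_{l-1}(t,X_{i_2}\cdots X_{i_l})\exp(t^{p_{i_1}}X_{i_1}).$$ Here $C_{\ell(I)}(t,X_I)$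 depends on the multiindex $I$, and $C_{\ell(I)}(t,X_I)^{-1}$ is the inverse of the map $x\mapsto C_{\ell(I)}(t,X_I)(x)$. *)

theory Defs
  imports "HOL-Analysis.Analysis"
begin

(* A vector field on Omega is the vector of its coefficients, a total function
   real^'p => real^'p; only its values on Omega are ever used (Omega is open, so this also
   holds for the derivatives taken below). *)

definition partial_derivative :: "'p::finite \<Rightarrow> (real^'p \<Rightarrow> real) \<Rightarrow> real^'p \<Rightarrow> real" where
  "partial_derivative j f x = frechet_derivative f (at x) (axis j 1)"

(* C^k(closure Omega): all partial derivatives up to order k exist in Omega and extend
   continuously to the closure. Frechet differentiability at each stage costs nothing, since
   the partial derivatives are continuous in the open set Omega. *)
primrec Ck_closure :: "nat \<Rightarrow> (real^'p::finite) set \<Rightarrow> (real^'p \<Rightarrow> real) \<Rightarrow> bool" where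
  "Ck_closure 0 \<Omega> f \<longleftrightarrow> (\<exists>g. continuous_on (closure \<Omega>) g \<and> (\<forall>x\<in>\<Omega>. g x = f x))"
| "Ck_closure (Suc k) \<Omega> f \<longleftrightarrow>
     (\<exists>g. continuous_on (closure \<Omega>) g \<and> (\<forall>x\<in>\<Omega>. g x = f x)) \<and>
     (\<forall>x\<in>\<Omega>. f differentiable (at x)) \<and>
     (\<forall>j. Ck_closure k \<Omega> (partial_derivative j f))"

(* X f, the sum over j of X_j times the j-th partial derivative of f. *)
definition vf_apply :: "(real^'p::finite \<Rightarrow> real^'p) \<Rightarrow> (real^'p \<Rightarrow> real) \<Rightarrow> real^'p \<Rightarrow> real" where
  "vf_apply X f x = frechet_derivative f (at x) (X x)"

(* [X,Y] = XY - YX is the first order operator whose j-th coefficient is its value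
   X(Y x_j) - Y(X x_j) on the j-th coordinate function; see vf_apply_lie_bracket. *)
definition lie_bracket ::
  "(real^'p::finite \<Rightarrow> real^'p) \<Rightarrow> (real^'p \<Rightarrow> real^'p) \<Rightarrow> real^'p \<Rightarrow> real^'p" where
  "lie_bracket X Y x = (\<chi> j. vf_apply X (\<lambda>y. Y y $ j) x - vf_apply Y (\<lambda>y. X y $ j) x)"

lemma vf_apply_eq_sum:
  assumes "f differentiable (at x)"
  shows "vf_apply X f x = (\<Sum>j\<in>UNIV. X x $ j * partial_derivative j f x)"
proof -
  have l: "linear (frechet_derivative f (at x))"
    using assms by (rule linear_frechet_derivative)
  have "vf_apply X f x = frechet_derivative f (at x) (\<Sum>j\<in>UNIV. X x $ j *\<^sub>R axis j 1)"
    by (simp add: vf_apply_def basis_expansion flip: scalar_mult_eq_scaleR)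
  then show ?thesis
    by (simp add: partial_derivative_def linear_sum[OF l] linear_cmul[OF l])
qed

lemma vf_apply_component:
  assumes "(Y has_derivative Y') (at x)"
  shows "vf_apply X (\<lambda>y. Y y $ j) x = Y' (X x) $ j"
proof -
  have "((\<lambda>y. Y y $ j) has_derivative (\<lambda>h. Y' h $ j)) (at x)"
    using assms by (rule bounded_linear.has_derivative[OF bounded_linear_vec_nth])
  then show ?thesis
    by (simp add: vf_apply_def frechet_derivative_at[symmetric])
qed

lemma vf_apply_lie_bracket:
  fixes f :: "real^'p::finite \<Rightarrow> real"
    and f' :: "real^'p \<Rightarrow> ((real^'p) \<Rightarrow>\<^sub>L real)"
  assumes "open S" "x \<in> S"
    and X: "X differentiable (at x)" and Y: "Y differentiable (at x)"
    and f': "\<And>y. y \<in> S \<Longrightarrow> (f has_derivative blinfun_apply (f' y)) (at y)"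
    and f'': "(f' has_derivative f'') (at x)"
    and sym: "\<And>u v. blinfun_apply (f'' u) v = blinfun_apply (f'' v) u"
  shows "vf_apply (lie_bracket X Y) f x
    = vf_apply X (vf_apply Y f) x - vf_apply Y (vf_apply X f) x"
proof -
  obtain X' where X': "(X has_derivative X') (at x)" using X by (auto simp: differentiable_def)
  obtain Y' where Y': "(Y has_derivative Y') (at x)" using Y by (auto simp: differentiable_def)
  have ap: "vf_apply Z f y = f' y (Z y)" if "y \<in> S" for Z y
    using frechet_derivative_at[OF f'[OF that]] by (simp add: vf_apply_def)
  have two: "vf_apply V (vf_apply Z f) x = f' x (Z' (V x)) + f'' (V x) (Z x)"
    if "(Z has_derivative Z') (at x)" for V Z Z'
  proof -
    have "((\<lambda>y. f' y (Z y)) has_derivative (\<lambda>h. f' x (Z' h) + f'' h (Z x))) (at x)"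
      by (rule bounded_bilinear.FDERIV[OF bounded_bilinear_blinfun_apply f'' that])
    then have "(vf_apply Z f has_derivative (\<lambda>h. f' x (Z' h) + f'' h (Z x))) (at x)"
      by (rule has_derivative_transform_within_open[OF _ assms(1,2)]) (simp add: ap)
    then show ?thesis
      by (simp add: vf_apply_def[of V] frechet_derivative_at[symmetric])
  qed
  have "lie_bracket X Y x = Y' (X x) - X' (Y x)"
    by (simp add: lie_bracket_def vec_eq_iff vf_apply_component[OF X'] vf_apply_component[OF Y'])
  then show ?thesis
    using sym[of "X x" "Y x"]
    by (simp add: ap[OF assms(2)] two[OF X'] two[OF Y'] blinfun.diff_right)
qed

definition weight :: "nat \<Rightarrow> nat" where
  "weight i = (if i = 0 then 2 else 1)"

definition multiindices :: "nat \<Rightarrow> nat list set" where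
  "multiindices n = {I. I \<noteq> [] \<and> set I \<subseteq> {0..n}}"

definition mweight :: "nat list \<Rightarrow> nat" where
  "mweight I = sum_list (map weight I)"

(* X_[I]; the value at the empty list, which is not a multiindex, is irrelevant. *)
fun iterated_bracket ::
  "(nat \<Rightarrow> real^'p::finite \<Rightarrow> real^'p) \<Rightarrow> nat list \<Rightarrow> real^'p \<Rightarrow> real^'p" where
  "iterated_bracket X [] = (\<lambda>x. 0)"
| "iterated_bracket X [i] = X i"
| "iterated_bracket X (i # j # J) = lie_bracket (X i) (iterated_bracket X (j # J))"

definition assumptions_B ::
  "(real^'p::finite) set \<Rightarrow> nat \<Rightarrow> nat \<Rightarrow> (nat \<Rightarrow> real^'p \<Rightarrow> real^'p) \<Rightarrow> bool" where
  "assumptions_B \<Omega> r n X \<longleftrightarrow>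
     (\<forall>i\<in>{1..n}. \<forall>j. Ck_closure (r - 1) \<Omega> (\<lambda>x. X i x $ j)) \<and>
     (\<forall>j. Ck_closure (r - 2) \<Omega> (\<lambda>x. X 0 x $ j)) \<and>
     (r = 2 \<longrightarrow> (\<forall>j. \<exists>L. L-lipschitz_on \<Omega> (\<lambda>x. X 0 x $ j))) \<and>
     (\<forall>x\<in>\<Omega>. span {iterated_bracket X I x | I. I \<in> multiindices n \<and> mweight I \<le> r} = UNIV)"

definition the_option :: "('a \<Rightarrow> bool) \<Rightarrow> 'a option" where
  "the_option P = (if \<exists>!y. P y then Some (THE y. P y) else None)"

definition integral_curve ::
  "(real^'p::finite) set \<Rightarrow> (real^'p \<Rightarrow> real^'p) \<Rightarrow> real \<Rightarrow> real^'p \<Rightarrow> (real \<Rightarrow> real^'p) \<Rightarrow> bool" where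
  "integral_curve \<Omega> X t x \<phi> \<longleftrightarrow> \<phi> 0 = x \<and>
     (\<forall>\<tau>\<in>closed_segment 0 t. \<phi> \<tau> \<in> \<Omega> \<and>
        (\<phi> has_vector_derivative X (\<phi> \<tau>)) (at \<tau> within closed_segment 0 t))"

(* exp(tX) as a partial map of Omega: None where no integral curve inside Omega exists up to
   time t (or, irrelevant for locally Lipschitz X, where its endpoint is not unique). *)
definition vf_exp ::
  "(real^'p::finite) set \<Rightarrow> real \<Rightarrow> (real^'p \<Rightarrow> real^'p) \<Rightarrow> real^'p \<rightharpoonup> real^'p" where
  "vf_exp \<Omega> t X x = the_option (\<lambda>y. \<exists>\<phi>. integral_curve \<Omega> X t x \<phi> \<and> \<phi> t = y)"

(* Inverse of a partial map; its domain is the range where the preimage is unique. *)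
definition partial_inv :: "('a \<rightharpoonup> 'b) \<Rightarrow> ('b \<rightharpoonup> 'a)" where
  "partial_inv f y = the_option (\<lambda>x. f x = Some y)"

(* C_l(t, X_I) with l = length I, on its maximal domain; exp(-sX) is the flow at time -s.
   The value at the empty list is irrelevant. *)
fun quasi_exp ::
  "(real^'p::finite) set \<Rightarrow> (nat \<Rightarrow> real^'p \<Rightarrow> real^'p) \<Rightarrow> real \<Rightarrow> nat list \<Rightarrow> real^'p \<rightharpoonup> real^'p"
  where
  "quasi_exp \<Omega> X t [] = Some"
| "quasi_exp \<Omega> X t [i] = vf_exp \<Omega> (t ^ weight i) (X i)"
| "quasi_exp \<Omega> X t (i # j # J) =
     partial_inv (quasi_exp \<Omega> X t (j # J)) \<circ>\<^sub>m vf_exp \<Omega> (- (t ^ weight i)) (X i) \<circ>\<^sub>m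
     quasi_exp \<Omega> X t (j # J) \<circ>\<^sub>m vf_exp \<Omega> (t ^ weight i) (X i)"

(* The remainder o(t^m), uniform on the closure of U. The absolute value allows t < 0 with
   m odd; the supremum is taken in the extended reals, where it always exists. *)
definition uniform_smallo ::
  "(real^'p::finite) set \<Rightarrow> nat \<Rightarrow> (real \<Rightarrow> real^'p \<Rightarrow> real^'p) \<Rightarrow> bool" where
  "uniform_smallo U m f \<longleftrightarrow>
     ((\<lambda>t. SUP x\<in>closure U. ereal (norm (f t x) / \<bar>t ^ m\<bar>)) \<longlongrightarrow> 0) (at 0)"

end

theory Submission
  imports Defs
begin

text \<open>
  By uniqueness of integral curves, \<open>C\<^sub>l(t, X\<^sub>I)\<close> and its inverse are plain compositions of flows
  \<open>exp(\<plusminus>t\<^bsup>p\<^esup> X\<^sub>i)\<close>. Pulling a function of class \<open>C\<^bsup>m\<^esup>\<close>, \<open>m \<le> r\<close>, back along such a composition gives an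
  expansion in the operators \<open>t\<^bsup>|w|\<^esup> X\<^sub>w\<close> with error \<open>o(t\<^bsup>m\<^esup>)\<close>, uniform on balls; each letter \<open>X\<^sub>i\<close> costs at
  most \<open>p\<^sub>i\<close> derivatives, so words of weight at most \<open>r\<close> never exhaust the regularity. The coefficients
  form a noncommutative power series, composition of flows is multiplication of series, and the
  flow of \<open>X\<^sub>i\<close> has the exponential series. In that ring the group commutator
  \<open>e\<^bsup>x\<^esup> A e\<^bsup>-x\<^esup> A\<^bsup>-1\<^esup>\<close> equals \<open>1 + [x, b]\<close> up to higher weight whenever \<open>A = 1 + b\<close> up to higher weight.
  Applied to the coordinate functions with \<open>m = |I|\<close>, this is the claim.
\<close>

section \<open>Formal series in noncommuting variables\<close>

text \<open>The obstacle is regularity in x. When \<open>r = 2\<close> the field \<open>X 0\<close>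
  is only Lipschitz, so its flow need not be differentiable in the initial point, and a Taylor
  formula for the composed map in x is out of reach. With pullbacks, flows are differentiated in
  time only, and all derivatives in x fall on the test function f. For f of class C^m the top
  coefficients are merely continuous; hence the errors are o(t^m), not O(t^(m+1)). The expansion
  must also be claimed for all m \<le> r and all f of class C^m at once: composing two maps applies
  the expansion of the inner one to X_v f, which has only class C^(m-|v|). Operators X_w f of large
  weight need not make sense, so the commutator algebra is done with formal series, where
  exponentials and inverses exist without any differentiability; a series is evaluated only after
  truncation at weight m.\<close>

definition word_conv :: "(nat list \<Rightarrow> real) \<Rightarrow> (nat list \<Rightarrow> real) \<Rightarrow> nat list \<Rightarrow> real" where
  "word_conv A B w = (\<Sum>k\<le>length w. A (take k w) * B (drop k w))"

lemma word_conv_Nil [simp]: "word_conv A B [] = A [] * B []"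
  by (simp add: word_conv_def)

lemma word_conv_Cons: "word_conv A B (x # w) = A [] * B (x # w) + word_conv (\<lambda>v. A (x # v)) B w"
  by (simp add: word_conv_def sum.atMost_Suc_shift del: sum.atMost_Suc)

lemma word_conv_add_left: "word_conv (\<lambda>w. A w + A' w) B w = word_conv A B w + word_conv A' B w"
  by (simp add: word_conv_def algebra_simps sum.distrib)

lemma word_conv_add_right: "word_conv A (\<lambda>w. B w + B' w) w = word_conv A B w + word_conv A B' w"
  by (simp add: word_conv_def algebra_simps sum.distrib)

lemma word_conv_scale_left: "word_conv (\<lambda>w. c * A w) B w = c * word_conv A B w"
  by (simp add: word_conv_def sum_distrib_left mult_ac)

lemma word_conv_zero_left: "word_conv (\<lambda>_. 0) B w = 0"
  by (simp add: word_conv_def)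

text \<open>Peeling the first letter x off the word replaces the left factor by its quotient
  \<open>\<lambda>v. A (x # v)\<close>, so the induction on the word must leave \<open>A\<close>
  arbitrary; bilinearity does the rest.\<close>

lemma word_conv_assoc: "word_conv (word_conv A B) C w = word_conv A (word_conv B C) w"
proof (induction w arbitrary: A)
  case (Cons x w)
  have "(\<lambda>v. word_conv A B (x # v)) = (\<lambda>v. A [] * B (x # v) + word_conv (\<lambda>v. A (x # v)) B v)"
    by (simp add: word_conv_Cons fun_eq_iff)
  then show ?case
    by (simp add: word_conv_Cons word_conv_add_left word_conv_scale_left Cons.IH algebra_simps)
qed simp

text \<open>A type of its own lets the concatenation product instantiate \<open>ring_1\<close>, so
  that the commutator identities below are left to \<open>algebra_simps\<close>. Infinite series are
  allowed: each coefficient of a product is a finite sum over the splittings of one word.\<close>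

typedef ncs = "UNIV :: (nat list \<Rightarrow> real) set" morphisms nccoeff Ncs
  by simp

setup_lifting type_definition_ncs

lemma ncs_eqI: "(\<And>w. nccoeff A w = nccoeff B w) \<Longrightarrow> A = B"
  by transfer auto

instantiation ncs :: ring_1
begin

lift_definition zero_ncs :: ncs is "\<lambda>_. 0" .
lift_definition one_ncs :: ncs is "\<lambda>w. if w = [] then 1 else 0" .
lift_definition plus_ncs :: "ncs \<Rightarrow> ncs \<Rightarrow> ncs" is "\<lambda>A B w. A w + B w" .
lift_definition minus_ncs :: "ncs \<Rightarrow> ncs \<Rightarrow> ncs" is "\<lambda>A B w. A w - B w" .
lift_definition uminus_ncs :: "ncs \<Rightarrow> ncs" is "\<lambda>A w. - A w" .
lift_definition times_ncs :: "ncs \<Rightarrow> ncs \<Rightarrow> ncs" is word_conv .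

instance
proof
  fix A B C :: ncs
  show "A * B * C = A * (B * C)"
    by transfer (simp add: word_conv_assoc fun_eq_iff)
  show "(A + B) * C = A * C + B * C"
    by transfer (simp add: word_conv_add_left fun_eq_iff)
  show "A * (B + C) = A * B + A * C"
    by transfer (simp add: word_conv_add_right fun_eq_iff)
  show "1 * A = A"
  proof (transfer, rule ext)
    fix A :: "nat list \<Rightarrow> real" and w
    show "word_conv (\<lambda>w. if w = [] then 1 else 0) A w = A w"
      by (cases w) (simp_all add: word_conv_Cons word_conv_zero_left)
  qed
  show "A * 1 = A"
  proof (transfer, rule ext)
    fix A :: "nat list \<Rightarrow> real" and w
    show "word_conv A (\<lambda>w. if w = [] then 1 else 0) w = A w"
      by (induction w arbitrary: A) (simp_all add: word_conv_Cons)
  qed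
  show "(0::ncs) \<noteq> 1"
    by transfer (metis zero_neq_one)
qed (transfer; simp add: fun_eq_iff)+

end

lemma nccoeff_zero [simp]: "nccoeff 0 w = 0" by transfer simp
lemma nccoeff_one: "nccoeff 1 w = (if w = [] then 1 else 0)" by transfer simp
lemma nccoeff_add [simp]: "nccoeff (A + B) w = nccoeff A w + nccoeff B w" by transfer simp
lemma nccoeff_diff [simp]: "nccoeff (A - B) w = nccoeff A w - nccoeff B w" by transfer simp
lemma nccoeff_uminus [simp]: "nccoeff (- A) w = - nccoeff A w" by transfer simp
lemma nccoeff_mult: "nccoeff (A * B) w = (\<Sum>k\<le>length w. nccoeff A (take k w) * nccoeff B (drop k w))"
  by transfer (simp add: word_conv_def)

section \<open>The weight filtration\<close>

lemma mweight_Nil [simp]: "mweight [] = 0"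
  by (simp add: mweight_def)
lemma mweight_Cons [simp]: "mweight (i # I) = weight i + mweight I"
  by (simp add: mweight_def)
lemma mweight_append [simp]: "mweight (I @ J) = mweight I + mweight J"
  by (simp add: mweight_def)
lemma weight_pos [simp]: "0 < weight i"
  by (simp add: weight_def)
lemma mweight_replicate [simp]: "mweight (replicate k i) = k * weight i"
  by (induction k) auto
lemma length_le_mweight: "length I \<le> mweight I"
proof (induction I)
  case (Cons i I)
  then show ?case
    by (simp add: weight_def)
qed simp

text \<open>These are the two-sided ideals of the weight filtration. Equality up to higher weight is
  expressed as membership of the difference in such an ideal.\<close>

definition vanish_below :: "nat \<Rightarrow> ncs \<Rightarrow> bool" where
  "vanish_below m A \<longleftrightarrow> (\<forall>w. mweight w < m \<longrightarrow> nccoeff A w = 0)"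

lemma vanish_below_0: "vanish_below 0 A"
  by (simp add: vanish_below_def)

lemma vanish_below_add: "vanish_below m A \<Longrightarrow> vanish_below m B \<Longrightarrow> vanish_below m (A + B)"
  by (simp add: vanish_below_def)

lemma vanish_below_diff: "vanish_below m A \<Longrightarrow> vanish_below m B \<Longrightarrow> vanish_below m (A - B)"
  by (simp add: vanish_below_def)

lemma vanish_below_uminus: "vanish_below m A \<Longrightarrow> vanish_below m (- A)"
  by (simp add: vanish_below_def)

lemma vanish_below_mono: "vanish_below m A \<Longrightarrow> k \<le> m \<Longrightarrow> vanish_below k A"
  by (simp add: vanish_below_def)

text \<open>Weights add under concatenation: if a word is too light, then in any splitting one of
  the two pieces lies below its bound. With \<open>vanish_below_0\<close> for one factor this is the
  ideal property.\<close>

lemma vanish_below_mult: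
  assumes "vanish_below a A" "vanish_below b B" "m \<le> a + b"
  shows "vanish_below m (A * B)"
  unfolding vanish_below_def nccoeff_mult
proof (intro allI impI sum.neutral ballI)
  fix w k assume w: "mweight w < m"
  have "mweight w = mweight (take k w) + mweight (drop k w)"
    by (metis append_take_drop_id mweight_append)
  then have "mweight (take k w) < a \<or> mweight (drop k w) < b"
    using w assms(3) by linarith
  then show "nccoeff A (take k w) * nccoeff B (drop k w) = 0"
    using assms by (auto simp: vanish_below_def)
qed

section \<open>Letters and their exponentials\<close>

lift_definition ncvar :: "nat \<Rightarrow> ncs" is "\<lambda>i w. if w = [i] then 1 else 0" .
lemma nccoeff_ncvar: "nccoeff (ncvar i) w = (if w = [i] then 1 else 0)" by transfer simp

text \<open>This is exp(s x_i): the condition \<open>set w \<subseteq> {i}\<close> selects the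
  powers of the letter i, the empty word included.\<close>

lift_definition ncexp :: "real \<Rightarrow> nat \<Rightarrow> ncs" is
  "\<lambda>s i w. if set w \<subseteq> {i} then s ^ length w / fact (length w) else 0" .

lemma nccoeff_ncexp:
  "nccoeff (ncexp s i) w = (if set w \<subseteq> {i} then s ^ length w / fact (length w) else 0)"
  by transfer simp

text \<open>Both pieces of a power of i are again powers of i, and for such words the claim is the
  binomial theorem; any other word has a foreign letter in one of its pieces.\<close>

lemma ncexp_mult: "ncexp s i * ncexp s' i = ncexp (s + s') i"
proof (rule ncs_eqI)
  fix w
  show "nccoeff (ncexp s i * ncexp s' i) w = nccoeff (ncexp (s + s') i) w"
  proof (cases "set w \<subseteq> {i}")
    case True
    let ?n = "length w"
    have *: "set (take k w) \<subseteq> {i}" "set (drop k w) \<subseteq> {i}" for k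
      using True set_take_subset[of k w] set_drop_subset[of k w] by blast+
    have "nccoeff (ncexp s i * ncexp s' i) w
      = (\<Sum>k\<le>?n. s ^ k / fact k * (s' ^ (?n - k) / fact (?n - k)))"
      unfolding nccoeff_mult nccoeff_ncexp by (intro sum.cong refl) (simp add: * min_def)
    also have "\<dots> = (\<Sum>k\<le>?n. of_nat (?n choose k) * s ^ k * s' ^ (?n - k)) / fact ?n"
      unfolding sum_divide_distrib
      by (intro sum.cong refl) (simp add: binomial_fact field_simps)
    finally show ?thesis
      using True by (simp add: nccoeff_ncexp binomial_ring)
  next
    case False
    have "nccoeff (ncexp s i) (take k w) * nccoeff (ncexp s' i) (drop k w) = 0" for k
      using False set_append[of "take k w" "drop k w"] by (auto simp: nccoeff_ncexp)
    then show ?thesis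
      using False by (simp only: nccoeff_mult) (simp add: nccoeff_ncexp)
  qed
qed

lemma ncexp_0: "ncexp 0 i = 1"
  by (rule ncs_eqI) (auto simp: nccoeff_ncexp nccoeff_one power_0_left)

text \<open>Apart from the empty word and the single letter, the powers of i weigh at least
  \<open>2 * weight i\<close>, which exceeds \<open>weight i\<close>.\<close>

lemma ncexp_linear_part: "vanish_below (Suc (weight i)) (ncexp 1 i - 1 - ncvar i)"
  unfolding vanish_below_def
proof (intro allI impI)
  fix w assume w: "mweight w < Suc (weight i)"
  show "nccoeff (ncexp 1 i - 1 - ncvar i) w = 0"
  proof (cases w)
    case (Cons j v)
    then show ?thesis using w
      by (cases v) (auto simp: nccoeff_ncexp nccoeff_one nccoeff_ncvar weight_def split: if_splits)
  qed (auto simp: nccoeff_ncexp nccoeff_one nccoeff_ncvar)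
qed

section \<open>Words of bounded weight\<close>

definition words :: "nat \<Rightarrow> nat \<Rightarrow> nat list set" where
  "words n m = {w. set w \<subseteq> {0..n} \<and> mweight w \<le> m}"

lemma finite_words: "finite (words n m)"
proof (rule finite_subset)
  show "words n m \<subseteq> {w. set w \<subseteq> {0..n} \<and> length w \<le> m}"
    unfolding words_def using length_le_mweight order_trans by blast
qed (simp add: finite_lists_length_le)

text \<open>Cutting a word at position k matches the pairs (w, k) with the pairs (u, v) of joint
  weight at most m. The subtraction \<open>m - mweight u\<close> is exact because u itself has
  weight at most m.\<close>

lemma sum_words_mult:
  "(\<Sum>w\<in>words n m. nccoeff (A * B) w * G w)
    = (\<Sum>u\<in>words n m. \<Sum>v\<in>words n (m - mweight u). nccoeff A u * nccoeff B v * (G (u @ v) :: real))"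
proof -
  have "(\<Sum>w\<in>words n m. nccoeff (A * B) w * G w)
    = (\<Sum>(w, k)\<in>Sigma (words n m) (\<lambda>w. {..length w}). nccoeff A (take k w) * nccoeff B (drop k w) * G w)"
    by (simp add: nccoeff_mult sum_distrib_right sum.Sigma finite_words)
  also have "\<dots> = (\<Sum>(u, v)\<in>Sigma (words n m) (\<lambda>u. words n (m - mweight u)).
      nccoeff A u * nccoeff B v * G (u @ v))"
  proof (rule sum.reindex_bij_witness[where j = "\<lambda>(w, k). (take k w, drop k w)"
        and i = "\<lambda>(u, v). (u @ v, length u)"])
    fix a assume "a \<in> Sigma (words n m) (\<lambda>w. {..length w})"
    then obtain w k where a: "a = (w, k)" "w \<in> words n m" "k \<le> length w" by auto
    have "mweight w = mweight (take k w) + mweight (drop k w)"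
      by (metis append_take_drop_id mweight_append)
    then show "(case a of (w, k) \<Rightarrow> (take k w, drop k w)) \<in> Sigma (words n m) (\<lambda>u. words n (m - mweight u))"
      using a by (auto simp: words_def dest!: in_set_takeD in_set_dropD)
  qed (auto simp: words_def subset_iff)
  finally show ?thesis
    by (simp add: sum.Sigma finite_words)
qed

section \<open>Integral curves\<close>

text \<open>The regularity on which uniqueness of integral curves rests; unlike C^1, it is still
  available for \<open>X 0\<close> when \<open>r = 2\<close>.\<close>

definition locally_lipschitz :: "(real^'p::finite) set \<Rightarrow> (real^'p \<Rightarrow> real^'p) \<Rightarrow> bool" where
  "locally_lipschitz \<Omega> X \<longleftrightarrow> (\<forall>y\<in>\<Omega>. \<exists>e>0. \<exists>L. cball y e \<subseteq> \<Omega> \<and> L-lipschitz_on (cball y e) X)"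

lemma integral_curve_continuous_on:
  "integral_curve \<Omega> X t x \<phi> \<Longrightarrow> continuous_on (closed_segment 0 t) \<phi>"
  unfolding integral_curve_def continuous_on_eq_continuous_within
  by (blast intro: has_vector_derivative_continuous)

lemma integral_curve_restrict:
  assumes "integral_curve \<Omega> X t x \<phi>" "t' \<in> closed_segment 0 t"
  shows "integral_curve \<Omega> X t' x \<phi>"
proof -
  have "closed_segment 0 t' \<subseteq> closed_segment 0 t"
    using assms(2) by (simp add: subset_closed_segment)
  then show ?thesis
    using assms(1) unfolding integral_curve_def
    by (blast intro: has_vector_derivative_within_subset)
qed

lemma integral_curve_reverse:
  assumes "integral_curve \<Omega> X t x \<phi>"
  shows "integral_curve \<Omega> X (- t) (\<phi> t) (\<lambda>\<tau>. \<phi> (t + \<tau>))"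
  unfolding integral_curve_def
proof (intro conjI ballI)
  fix \<tau> assume \<tau>: "\<tau> \<in> closed_segment 0 (- t)"
  have im: "(+) t ` closed_segment 0 (- t) = closed_segment 0 t"
    by (simp add: closed_segment_translation[symmetric] closed_segment_commute)
  then have mem: "t + \<tau> \<in> closed_segment 0 t"
    using \<tau> by blast
  show "\<phi> (t + \<tau>) \<in> \<Omega>"
    using assms mem by (auto simp: integral_curve_def)
  have "((+) t has_vector_derivative 1) (at \<tau> within closed_segment 0 (- t))"
    by (auto intro!: derivative_eq_intros)
  moreover have "(\<phi> has_vector_derivative X (\<phi> (t + \<tau>))) (at (t + \<tau>) within (+) t ` closed_segment 0 (- t))"
    using assms mem by (simp add: integral_curve_def im)
  ultimately show "((\<lambda>\<tau>. \<phi> (t + \<tau>)) has_vector_derivative X (\<phi> (t + \<tau>)))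
      (at \<tau> within closed_segment 0 (- t))"
    using vector_diff_chain_within by (fastforce simp: o_def)
qed simp

lemma integral_curve_negate:
  assumes "integral_curve \<Omega> (\<lambda>x. - X x) t x \<phi>"
  shows "integral_curve \<Omega> X (- t) x (\<lambda>\<tau>. \<phi> (- \<tau>))"
  unfolding integral_curve_def
proof (intro conjI ballI)
  show "\<phi> (- 0) = x"
    using assms by (simp add: integral_curve_def)
  fix \<tau> assume \<tau>: "\<tau> \<in> closed_segment 0 (- t)"
  have im: "uminus ` closed_segment 0 (- t) = closed_segment 0 t"
    by (auto simp: closed_segment_eq_real_ivl image_iff)
  then have mem: "- \<tau> \<in> closed_segment 0 t"
    using \<tau> by blast
  show "\<phi> (- \<tau>) \<in> \<Omega>"
    using assms mem by (auto simp: integral_curve_def)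
  have "(uminus has_vector_derivative - 1) (at \<tau> within closed_segment 0 (- t))"
    by (auto intro!: derivative_eq_intros)
  moreover have "(\<phi> has_vector_derivative - X (\<phi> (- \<tau>))) (at (- \<tau>) within uminus ` closed_segment 0 (- t))"
    using assms mem by (simp add: integral_curve_def im)
  ultimately show "((\<lambda>\<tau>. \<phi> (- \<tau>)) has_vector_derivative X (\<phi> (- \<tau>)))
      (at \<tau> within closed_segment 0 (- t))"
    using vector_diff_chain_within by (fastforce simp: o_def)
qed

lemma onorm_scaleR_vector_le:
  fixes v :: "'a::real_normed_vector"
  assumes "norm v \<le> B"
  shows "onorm (\<lambda>h. h *\<^sub>R v) \<le> B"
proof (rule onorm_le)
  fix h :: real
  have "\<bar>h\<bar> * norm v \<le> \<bar>h\<bar> * B"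
    using assms by (intro mult_left_mono) auto
  then show "norm (h *\<^sub>R v) \<le> B * norm h"
    by (simp add: mult.commute)
qed

text \<open>Gronwall's inequality on a short segment, by a maximum argument: at the point \<sigma>
  where |u| is largest, the mean value bound gives |u(\<sigma>)| \<le> |u(\<sigma>)| / 2.\<close>

lemma norm_le_half_imp_zero:
  fixes u :: "real \<Rightarrow> 'a::real_normed_vector"
  assumes u': "\<And>\<sigma>. \<sigma> \<in> closed_segment a b \<Longrightarrow>
      (u has_vector_derivative u' \<sigma>) (at \<sigma> within closed_segment a b)"
    and le: "\<And>\<sigma>. \<sigma> \<in> closed_segment a b \<Longrightarrow> norm (u' \<sigma>) \<le> L * norm (u \<sigma>)"
    and "u a = 0" "0 \<le> L" "L * \<bar>b - a\<bar> \<le> 1 / 2"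
  shows "u b = 0"
proof -
  let ?J = "closed_segment a b"
  have "continuous_on ?J (\<lambda>\<sigma>. norm (u \<sigma>))"
    using continuous_on_vector_derivative[OF u'] by (rule continuous_on_norm)
  then obtain \<sigma> where \<sigma>: "\<sigma> \<in> ?J" "\<And>\<tau>. \<tau> \<in> ?J \<Longrightarrow> norm (u \<tau>) \<le> norm (u \<sigma>)"
    using continuous_attains_sup[of ?J "\<lambda>\<sigma>. norm (u \<sigma>)"] by auto
  have "norm (u \<sigma> - u a) \<le> (L * norm (u \<sigma>)) * norm (\<sigma> - a)"
  proof (rule differentiable_bound[where f' = "\<lambda>\<tau> h. h *\<^sub>R u' \<tau>" and S = ?J])
    show "(u has_derivative (\<lambda>h. h *\<^sub>R u' \<tau>)) (at \<tau> within ?J)" if "\<tau> \<in> ?J" for \<tau>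
      using u'[OF that] by (simp add: has_vector_derivative_def)
    show "onorm (\<lambda>h. h *\<^sub>R u' \<tau>) \<le> L * norm (u \<sigma>)" if "\<tau> \<in> ?J" for \<tau>
      using le[OF that] \<sigma>(2)[OF that] \<open>0 \<le> L\<close>
      by (intro onorm_scaleR_vector_le) (meson mult_left_mono order_trans)

  qed (use \<sigma> in auto)
  also have "\<dots> \<le> (L * \<bar>b - a\<bar>) * norm (u \<sigma>)"
  proof -
    have "\<bar>\<sigma> - a\<bar> \<le> \<bar>b - a\<bar>"
      using \<sigma>(1) by (auto simp: closed_segment_eq_real_ivl split: if_splits)
    then show ?thesis
      using \<open>0 \<le> L\<close> by (simp add: mult_left_mono mult_right_mono mult_ac)
  qed
  also have "\<dots> \<le> 1 / 2 * norm (u \<sigma>)"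
    using assms(5) by (intro mult_right_mono) auto
  finally have "norm (u \<sigma>) \<le> 0"
    using \<open>u a = 0\<close> by simp
  then show ?thesis
    using \<sigma>(2)[of b] by simp
qed

text \<open>The set where the curves agree is closed by continuity. It is open because near a common
  point both curves stay in one ball of Lipschitz continuity, where
  \<open>norm_le_half_imp_zero\<close> applies. A segment is connected.\<close>

lemma integral_curve_unique:
  assumes lip: "locally_lipschitz \<Omega> X"
    and \<phi>: "integral_curve \<Omega> X t x \<phi>" and \<psi>: "integral_curve \<Omega> X t x \<psi>"
    and "\<tau> \<in> closed_segment 0 t"
  shows "\<phi> \<tau> = \<psi> \<tau>"
proof -
  let ?S = "closed_segment 0 t"
  let ?T = "{\<tau> \<in> ?S. \<phi> \<tau> - \<psi> \<tau> = 0}"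
  note cont = integral_curve_continuous_on[OF \<phi>] integral_curve_continuous_on[OF \<psi>]
  have "closedin (top_of_set ?S) ?T"
    by (intro continuous_closedin_preimage_constant continuous_on_diff cont)
  moreover have "openin (top_of_set ?S) ?T"
    unfolding openin_euclidean_subtopology_iff
  proof (intro conjI ballI)
    fix a assume a: "a \<in> ?T"
    then have aS: "a \<in> ?S" by simp
    then have "\<phi> a \<in> \<Omega>"
      using \<phi> by (auto simp: integral_curve_def)
    then obtain e L where e: "e > 0" and L: "L-lipschitz_on (cball (\<phi> a) e) X"
      using lip by (auto simp: locally_lipschitz_def)
    have "L \<ge> 0"
      using L by (rule lipschitz_on_nonneg)
    obtain d1 where d1: "d1 > 0" "\<And>\<tau>. \<tau> \<in> ?S \<Longrightarrow> dist \<tau> a < d1 \<Longrightarrow> dist (\<phi> \<tau>) (\<phi> a) < e"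
      using cont(1) aS \<open>e > 0\<close> unfolding continuous_on_iff by blast
    obtain d2 where d2: "d2 > 0" "\<And>\<tau>. \<tau> \<in> ?S \<Longrightarrow> dist \<tau> a < d2 \<Longrightarrow> dist (\<psi> \<tau>) (\<psi> a) < e"
      using cont(2) aS \<open>e > 0\<close> unfolding continuous_on_iff by blast
    \<comment> \<open>The last bound makes L times the length at most 1/2; writing L + 1 covers L =
      0.\<close>
    define d where "d = min (min d1 d2) (1 / (2 * (L + 1)))"
    have "d > 0"
      using d1 d2 \<open>L \<ge> 0\<close> by (simp add: d_def)
    moreover have "b \<in> ?T" if b: "b \<in> ?S" "dist b a < d" for b
    proof -
      have sub: "closed_segment a b \<subseteq> ?S"
        using a b by (simp add: subset_closed_segment)
      have near: "\<phi> \<sigma> \<in> cball (\<phi> a) e" "\<psi> \<sigma> \<in> cball (\<phi> a) e" if "\<sigma> \<in> closed_segment a b" for \<sigma>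
      proof -
        have "dist \<sigma> a \<le> dist b a"
          using that by (auto simp: closed_segment_eq_real_ivl dist_real_def split: if_splits)
        then have "dist \<sigma> a < d1" "dist \<sigma> a < d2"
          using b by (auto simp: d_def)
        then show "\<phi> \<sigma> \<in> cball (\<phi> a) e" "\<psi> \<sigma> \<in> cball (\<phi> a) e"
          using d1(2)[of \<sigma>] d2(2)[of \<sigma>] that sub a by (force simp: dist_commute)+
      qed
      have "\<phi> b - \<psi> b = 0"
      proof (rule norm_le_half_imp_zero[where u = "\<lambda>\<tau>. \<phi> \<tau> - \<psi> \<tau>" and a = a and L = L
            and u' = "\<lambda>\<tau>. X (\<phi> \<tau>) - X (\<psi> \<tau>)"])
        fix \<sigma> assume \<sigma>: "\<sigma> \<in> closed_segment a b"
        show "((\<lambda>\<tau>. \<phi> \<tau> - \<psi> \<tau>) has_vector_derivative X (\<phi> \<sigma>) - X (\<psi> \<sigma>))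
            (at \<sigma> within closed_segment a b)"
          using \<phi> \<psi> \<sigma> sub unfolding integral_curve_def
          by (intro has_vector_derivative_diff) (blast intro: has_vector_derivative_within_subset)+
        show "norm (X (\<phi> \<sigma>) - X (\<psi> \<sigma>)) \<le> L * norm (\<phi> \<sigma> - \<psi> \<sigma>)"
          using lipschitz_onD[OF L near[OF \<sigma>]] by (simp add: dist_norm)
      next
        have "L * \<bar>b - a\<bar> \<le> L * (1 / (2 * (L + 1)))"
          using b \<open>L \<ge> 0\<close> by (intro mult_left_mono) (auto simp: d_def dist_real_def)
        also have "\<dots> \<le> 1 / 2"
          using \<open>L \<ge> 0\<close> by (simp add: field_simps)
        finally show "L * \<bar>b - a\<bar> \<le> 1 / 2" .
      qed (use a \<open>L \<ge> 0\<close> in auto)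
      then show ?thesis
        using b by simp
    qed
    ultimately show "\<exists>e>0. \<forall>b\<in>?S. dist b a < e \<longrightarrow> b \<in> ?T"
      by blast
  qed auto
  moreover have "0 \<in> ?T"
    using \<phi> \<psi> by (auto simp: integral_curve_def)
  moreover have "connected ?S"
    by simp
  ultimately have "?T = ?S"
    unfolding connected_clopen by (metis (no_types, lifting) empty_iff)
  then show ?thesis
    using assms(4) by auto
qed

section \<open>Flows as partial maps, and words of flows\<close>

lemma the_option_eq_Some:
  assumes "\<And>y z. P y \<Longrightarrow> P z \<Longrightarrow> y = z"
  shows "the_option P = Some y \<longleftrightarrow> P y"
  using assms by (auto simp: the_option_def intro: theI the_equality)

lemma vf_exp_eq_Some:
  assumes "locally_lipschitz \<Omega> X"
  shows "vf_exp \<Omega> t X x = Some y \<longleftrightarrow> (\<exists>\<phi>. integral_curve \<Omega> X t x \<phi> \<and> \<phi> t = y)"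
  unfolding vf_exp_def
  by (rule the_option_eq_Some) (use integral_curve_unique[OF assms] in fastforce)

text \<open>Running a curve backwards proves one implication, and the other one is the same
  implication at time -t. No smallness of t enters.\<close>

lemma vf_exp_reverse:
  assumes "locally_lipschitz \<Omega> X"
  shows "vf_exp \<Omega> t X x = Some y \<longleftrightarrow> vf_exp \<Omega> (- t) X y = Some x"
proof -
  have "vf_exp \<Omega> (- t) X y = Some x" if xy: "vf_exp \<Omega> t X x = Some y" for t x y
  proof -
    obtain \<phi> where \<phi>: "integral_curve \<Omega> X t x \<phi>" "\<phi> t = y"
      using xy by (auto simp: vf_exp_eq_Some[OF assms])
    moreover have "\<phi> 0 = x"
      using \<phi>(1) by (simp add: integral_curve_def)
    ultimately show ?thesis
      using integral_curve_reverse[OF \<phi>(1)] by (force simp: vf_exp_eq_Some[OF assms])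
  qed
  from this[of t x y] this[of "- t" y x] show ?thesis
    by auto
qed

text \<open>A word lists the flows in the order in which they act, head first, which is the reverse
  of the notation for composition. With this order the pullback series multiply in the order of the
  list.\<close>

fun flow_word ::
  "(real^'p::finite) set \<Rightarrow> (nat \<Rightarrow> real^'p \<Rightarrow> real^'p) \<Rightarrow> real \<Rightarrow> (real \<times> nat) list \<Rightarrow> real^'p \<rightharpoonup> real^'p"
  where
  "flow_word \<Omega> X t [] = Some"
| "flow_word \<Omega> X t ((s, i) # w) = flow_word \<Omega> X t w \<circ>\<^sub>m vf_exp \<Omega> (s * t ^ weight i) (X i)"

definition inv_word :: "(real \<times> nat) list \<Rightarrow> (real \<times> nat) list" where
  "inv_word w = rev (map (\<lambda>(s, i). (- s, i)) w)"

fun comm_word :: "nat list \<Rightarrow> (real \<times> nat) list" where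
  "comm_word [] = []"
| "comm_word [i] = [(1, i)]"
| "comm_word (i # j # J) =
     (1, i) # comm_word (j # J) @ (- 1, i) # inv_word (comm_word (j # J))"

lemma flow_word_append: "flow_word \<Omega> X t (v @ w) = flow_word \<Omega> X t w \<circ>\<^sub>m flow_word \<Omega> X t v"
proof (induction v)
  case (Cons a v)
  then show ?case
    by (cases a) (auto simp: map_comp_def fun_eq_iff split: option.splits)
qed (simp add: map_comp_def)

lemma inv_word_simps [simp]:
  "inv_word [] = []"
  "inv_word ((s, i) # w) = inv_word w @ [(- s, i)]"
  by (simp_all add: inv_word_def)

lemma snd_inv_word [simp]: "snd ` set (inv_word w) = snd ` set w"
  by (force simp: inv_word_def)

lemma snd_comm_word: "snd ` set (comm_word I) = set I"
  by (induction I rule: comm_word.induct) (auto simp: image_Un)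

lemma flow_word_inverse:
  assumes "\<And>i. i \<in> snd ` set w \<Longrightarrow> locally_lipschitz \<Omega> (X i)"
  shows "flow_word \<Omega> X t w x = Some y \<longleftrightarrow> flow_word \<Omega> X t (inv_word w) y = Some x"
  using assms
proof (induction w arbitrary: x)
  case (Cons a w)
  obtain s i where a: "a = (s, i)" by force
  have *: "vf_exp \<Omega> (s * t ^ weight i) (X i) x = Some z
      \<longleftrightarrow> vf_exp \<Omega> (- (s * t ^ weight i)) (X i) z = Some x" for z
    using Cons.prems[of i] by (intro vf_exp_reverse) (simp add: a)
  have "flow_word \<Omega> X t w z = Some y \<longleftrightarrow> flow_word \<Omega> X t (inv_word w) y = Some z" for z
    by (rule Cons.IH) (use Cons.prems in auto)
  then show ?case
    unfolding a flow_word.simps inv_word_simps flow_word_append map_comp_Some_iff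
    using * by (auto simp: map_comp_def)
qed auto

text \<open>The uniqueness of the preimage demanded by \<open>partial_inv\<close> is automatic: two
  preimages of y would both be the value at y of the inverse word. So the maximal domains agree as
  well, for every t.\<close>

lemma partial_inv_flow_word:
  assumes "\<And>i. i \<in> snd ` set w \<Longrightarrow> locally_lipschitz \<Omega> (X i)"
  shows "partial_inv (flow_word \<Omega> X t w) = flow_word \<Omega> X t (inv_word w)"
proof
  fix y
  have "partial_inv (flow_word \<Omega> X t w) y = Some x \<longleftrightarrow> flow_word \<Omega> X t (inv_word w) y = Some x" for x
  proof -
    have "partial_inv (flow_word \<Omega> X t w) y = Some x \<longleftrightarrow> flow_word \<Omega> X t w x = Some y"
      unfolding partial_inv_def
    proof (rule the_option_eq_Some)
      fix a b
      assume "flow_word \<Omega> X t w a = Some y" "flow_word \<Omega> X t w b = Some y"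
      then have "flow_word \<Omega> X t (inv_word w) y = Some a" "flow_word \<Omega> X t (inv_word w) y = Some b"
        using flow_word_inverse[where w = w and X = X, OF assms] by blast+
      then show "a = b" by simp
    qed
    then show ?thesis
      using flow_word_inverse[where w = w and X = X, OF assms] by blast
  qed
  then show "partial_inv (flow_word \<Omega> X t w) y = flow_word \<Omega> X t (inv_word w) y"
    by (metis option.exhaust)
qed

lemma quasi_exp_eq_flow_word:
  assumes "\<And>i. i \<in> set I \<Longrightarrow> locally_lipschitz \<Omega> (X i)"
  shows "quasi_exp \<Omega> X t I = flow_word \<Omega> X t (comm_word I)"
  using assms
proof (induction I rule: comm_word.induct)
  case (3 i j J)
  have IH: "quasi_exp \<Omega> X t (j # J) = flow_word \<Omega> X t (comm_word (j # J))"
    by (rule "3.IH") (use "3.prems" in auto)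
  have inv: "partial_inv (flow_word \<Omega> X t (comm_word (j # J))) = flow_word \<Omega> X t (inv_word (comm_word (j # J)))"
    by (rule partial_inv_flow_word) (use "3.prems" in \<open>simp add: snd_comm_word\<close>)
  show ?case
    unfolding quasi_exp.simps IH inv comm_word.simps flow_word.simps flow_word_append
    by (auto simp: map_comp_def fun_eq_iff split: option.splits)
qed (auto simp: map_comp_def fun_eq_iff split: option.splits)

section \<open>Existence of short integral curves\<close>

text \<open>Banach's fixed point theorem in the space of bounded continuous functions; the global
  Lipschitz bound makes the Picard map a contraction with factor T L without any control of its
  range.\<close>

lemma picard_global:
  fixes Y :: "'a::euclidean_space \<Rightarrow> 'a"
  assumes lip: "L-lipschitz_on UNIV Y" and "0 \<le> T" "T * L < 1"
  shows "\<exists>\<phi>. \<phi> 0 = x \<and> (\<forall>\<tau>\<in>{0..T}. (\<phi> has_vector_derivative Y (\<phi> \<tau>)) (at \<tau> within {0..T}))"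
proof -
  have "L \<ge> 0"
    using lip by (rule lipschitz_on_nonneg)
  define F where "F \<phi> \<tau> = x + integral {0..\<tau>} (\<lambda>s. Y (apply_bcontfun \<phi> s))" for \<phi> :: "real \<Rightarrow>\<^sub>C 'a" and \<tau>
  have contY: "continuous_on S (\<lambda>s. Y (apply_bcontfun \<phi> s))" for \<phi> :: "real \<Rightarrow>\<^sub>C 'a" and S
    using continuous_on_compose2[OF lipschitz_on_continuous_on[OF lip], of S "apply_bcontfun \<phi>"] by simp
  \<comment> \<open>\<open>clamp\<close> freezes the integral outside [0, T], which makes the Picard
    iterate bounded on the whole line; the fixed point is used as a solution on the interval
    only.\<close>
  have "\<exists>g :: real \<Rightarrow>\<^sub>C 'a. \<forall>\<tau>. apply_bcontfun g \<tau> = F \<phi> (clamp 0 T \<tau>)" for \<phi>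
  proof -
    have "continuous_on (cbox 0 T) (F \<phi>)"
      unfolding F_def cbox_interval
      by (intro continuous_intros indefinite_integral_continuous_1 integrable_continuous_real contY)
    then show ?thesis
      by (rule continuous_on_cbox_bcontfunE) blast
  qed
  then obtain P :: "(real \<Rightarrow>\<^sub>C 'a) \<Rightarrow> real \<Rightarrow>\<^sub>C 'a"
    where P: "\<And>\<phi> \<tau>. apply_bcontfun (P \<phi>) \<tau> = F \<phi> (clamp 0 T \<tau>)"
    by metis
  have "dist (P \<phi>) (P \<psi>) \<le> (T * L) * dist \<phi> \<psi>" for \<phi> \<psi>
  proof (rule dist_bound)
    fix \<tau>
    define c where "c = clamp 0 T \<tau>"
    have c: "c \<in> {0..T}"
      using clamp_in_interval[of 0 T \<tau>] \<open>0 \<le> T\<close> by (simp add: c_def)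
    have "norm (integral {0..c} (\<lambda>s. Y (\<phi> s) - Y (\<psi> s))) \<le> (L * dist \<phi> \<psi>) * (c - 0)"
    proof (rule integral_bound)
      show "norm (Y (\<phi> s) - Y (\<psi> s)) \<le> L * dist \<phi> \<psi>" for s
      proof -
        have "norm (Y (\<phi> s) - Y (\<psi> s)) \<le> L * dist (\<phi> s) (\<psi> s)"
          using lipschitz_onD[OF lip] by (simp add: dist_norm)
        also have "\<dots> \<le> L * dist \<phi> \<psi>"
          using \<open>L \<ge> 0\<close> by (intro mult_left_mono dist_bounded)
        finally show ?thesis .
      qed
    qed (use c in \<open>auto intro!: continuous_on_diff contY\<close>)
    also have "\<dots> \<le> (T * L) * dist \<phi> \<psi>"
      using c \<open>L \<ge> 0\<close> mult_right_mono[of c T "L * dist \<phi> \<psi>"] by (simp add: mult_ac)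
    finally show "dist (apply_bcontfun (P \<phi>) \<tau>) (apply_bcontfun (P \<psi>) \<tau>) \<le> T * L * dist \<phi> \<psi>"
      by (simp add: P F_def dist_norm c_def integral_diff integrable_continuous_real contY)
  qed
  then obtain \<phi> where \<phi>: "P \<phi> = \<phi>"
    using banach_fix_type[of "T * L" P] assms \<open>L \<ge> 0\<close> by auto
  have eq: "\<phi> \<tau> = F \<phi> \<tau>" if "\<tau> \<in> {0..T}" for \<tau>
    using P[of \<phi> \<tau>] that by (simp add: \<phi>)
  have "(apply_bcontfun \<phi> has_vector_derivative Y (\<phi> \<tau>)) (at \<tau> within {0..T})" if "\<tau> \<in> {0..T}" for \<tau>
  proof (rule has_vector_derivative_transform[OF that])
    show "(F \<phi> has_vector_derivative Y (\<phi> \<tau>)) (at \<tau> within {0..T})"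
      unfolding F_def
      using has_vector_derivative_add[OF has_vector_derivative_const integral_has_vector_derivative[OF contY that]]
      by simp
  qed (simp add: eq)
  moreover have "\<phi> 0 = x"
    using eq[of 0] \<open>0 \<le> T\<close> by (simp add: F_def)
  ultimately show ?thesis
    by blast
qed

text \<open>The closest-point projection onto the ball is 1-Lipschitz, so composing X with it gives
  a globally Lipschitz field with the same constant. At speed at most M the solution stays within
  \<rho> + T M \<le> R of c, where the projection is the identity.\<close>

lemma picard_local:
  fixes X :: "'a::euclidean_space \<Rightarrow> 'a"
  assumes lip: "L-lipschitz_on (cball c R) X" and M: "\<And>y. y \<in> cball c R \<Longrightarrow> norm (X y) \<le> M"
    and x: "dist c x \<le> \<rho>" and "0 \<le> T" "T * L < 1" "\<rho> \<le> R" "\<rho> + T * M \<le> R"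
  shows "\<exists>\<phi>. \<phi> 0 = x \<and> (\<forall>\<tau>\<in>{0..T}. \<phi> \<tau> \<in> cball c (\<rho> + T * M) \<and>
      (\<phi> has_vector_derivative X (\<phi> \<tau>)) (at \<tau> within {0..T}))"
proof -
  let ?B = "cball c R"
  define p where "p = closest_point ?B"
  have "\<rho> \<ge> 0"
    using x zero_le_dist[of c x] by linarith
  then have "R \<ge> 0"
    using assms(6) by linarith
  then have ne: "?B \<noteq> {}" by simp
  have p_in: "p y \<in> ?B" for y
    unfolding p_def using ne by (intro closest_point_in_set) auto
  then have M0: "0 \<le> M"
    using M norm_ge_zero order_trans by blast
  have "1-lipschitz_on UNIV p"
    unfolding p_def using ne by (intro lipschitz_onI) (auto intro: closest_point_lipschitz)
  moreover have "L-lipschitz_on (p ` UNIV) X"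
    using lip by (rule lipschitz_on_subset) (use p_in in auto)
  ultimately have "(L * 1)-lipschitz_on UNIV (\<lambda>y. X (p y))"
    by (rule lipschitz_on_compose2)
  then obtain \<phi> where \<phi>: "\<phi> 0 = x"
    "\<And>\<tau>. \<tau> \<in> {0..T} \<Longrightarrow> (\<phi> has_vector_derivative X (p (\<phi> \<tau>))) (at \<tau> within {0..T})"
    using picard_global[of L "\<lambda>y. X (p y)" T x] assms by auto
  have in_ball: "\<phi> \<tau> \<in> cball c (\<rho> + T * M)" if \<tau>: "\<tau> \<in> {0..T}" for \<tau>
  proof -
    have "norm (\<phi> \<tau> - \<phi> 0) \<le> M * norm (\<tau> - 0)"
    proof (rule differentiable_bound[where f' = "\<lambda>\<tau> h. h *\<^sub>R X (p (\<phi> \<tau>))" and S = "{0..T}"])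
      show "onorm (\<lambda>h. h *\<^sub>R X (p (\<phi> \<sigma>))) \<le> M" for \<sigma>
        using M[OF p_in] by (rule onorm_scaleR_vector_le)
    qed (use \<phi>(2) \<tau> in \<open>auto simp: has_vector_derivative_def\<close>)
    also have "\<dots> \<le> T * M"
      using \<tau> M0 mult_right_mono[of \<tau> T M] by (simp add: mult.commute)
    finally have "dist x (\<phi> \<tau>) \<le> T * M"
      by (simp add: \<phi>(1) dist_norm norm_minus_commute)
    then show ?thesis
      using x dist_triangle[of c "\<phi> \<tau>" x] by (simp add: mem_cball)
  qed
  have "p (\<phi> \<tau>) = \<phi> \<tau>" if "\<tau> \<in> {0..T}" for \<tau>
    unfolding p_def using in_ball[OF that] assms(7) by (intro closest_point_self) auto
  then show ?thesis
    using \<phi> in_ball by (intro exI[of _ \<phi>]) auto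
qed

section \<open>Functions of class C^k on an open set\<close>

text \<open>The interior version of \<open>Ck_closure\<close>: later estimates take place on closed
  balls inside the domain, where compactness supplies the bounds.\<close>

primrec Ck :: "nat \<Rightarrow> (real^'p::finite) set \<Rightarrow> (real^'p \<Rightarrow> real) \<Rightarrow> bool" where
  "Ck 0 \<Omega> f \<longleftrightarrow> continuous_on \<Omega> f"
| "Ck (Suc k) \<Omega> f \<longleftrightarrow>
     (\<forall>x\<in>\<Omega>. f differentiable (at x)) \<and> (\<forall>j. Ck k \<Omega> (partial_derivative j f))"

lemma Ck_closure_imp_Ck: "Ck_closure k \<Omega> f \<Longrightarrow> Ck k \<Omega> f"
proof (induction k arbitrary: f)
  case 0
  then obtain g where "continuous_on (closure \<Omega>) g" "\<forall>x\<in>\<Omega>. g x = f x" by auto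
  then show ?case
    using continuous_on_subset[of "closure \<Omega>" g \<Omega>] closure_subset continuous_on_cong[of \<Omega> \<Omega> g f]
    by auto
qed auto

lemma Ck_continuous_on: "Ck k \<Omega> f \<Longrightarrow> continuous_on \<Omega> f"
  by (cases k) (auto intro!: continuous_at_imp_continuous_on differentiable_imp_continuous_within)

lemma Ck_SucD: "Ck (Suc k) \<Omega> f \<Longrightarrow> Ck k \<Omega> f"
proof (induction k arbitrary: f)
  case 0
  then show ?case using Ck_continuous_on[OF 0] by simp
next
  case (Suc k)
  then show ?case by (metis Ck.simps(2))
qed

lemma Ck_mono: "Ck m \<Omega> f \<Longrightarrow> k \<le> m \<Longrightarrow> Ck k \<Omega> f"
  by (induction m) (auto simp del: Ck.simps simp: le_Suc_eq dest: Ck_SucD)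

lemma Ck_differentiable: "Ck k \<Omega> f \<Longrightarrow> 0 < k \<Longrightarrow> x \<in> \<Omega> \<Longrightarrow> f differentiable (at x)"
  by (cases k) auto

lemma partial_derivative_eq:
  assumes "(f has_derivative f') (at x)"
  shows "partial_derivative j f x = f' (axis j 1)"
  using frechet_derivative_at[OF assms] by (simp add: partial_derivative_def)

text \<open>\<open>frechet_derivative\<close> is a choice among all derivatives, and f and g have
  the same ones at x; hence the equality also holds where neither is differentiable.\<close>

lemma frechet_derivative_cong_open:
  assumes "open \<Omega>" "x \<in> \<Omega>" "\<And>y. y \<in> \<Omega> \<Longrightarrow> f y = g y"
  shows "frechet_derivative f (at x) = frechet_derivative g (at x)"
proof -
  have "(f has_derivative f') (at x) \<longleftrightarrow> (g has_derivative f') (at x)" for f'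
    using has_derivative_transform_within_open[OF _ assms(1,2), of f f' UNIV g]
      has_derivative_transform_within_open[OF _ assms(1,2), of g f' UNIV f] assms(3) by auto
  then show ?thesis
    by (simp add: frechet_derivative_def)
qed

lemma Ck_cong_imp:
  assumes "open \<Omega>"
  shows "(\<And>x. x \<in> \<Omega> \<Longrightarrow> f x = g x) \<Longrightarrow> Ck k \<Omega> f \<Longrightarrow> Ck k \<Omega> g"
proof (induction k arbitrary: f g)
  case 0
  then show ?case by (metis Ck.simps(1) continuous_on_cong)
next
  case (Suc k)
  have "g differentiable (at x)" if "x \<in> \<Omega>" for x
  proof -
    obtain f' where "(f has_derivative f') (at x)"
      using Suc.prems \<open>x \<in> \<Omega>\<close> by (auto simp: differentiable_def)
    then have "(g has_derivative f') (at x)"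
      by (rule has_derivative_transform_within_open[OF _ assms that]) (rule Suc.prems)
    then show ?thesis by (auto simp: differentiable_def)
  qed
  moreover have "partial_derivative j f x = partial_derivative j g x" if "x \<in> \<Omega>" for j x
    unfolding partial_derivative_def
    using frechet_derivative_cong_open[OF assms that, of f g] Suc.prems by simp
  ultimately show ?case
    using Suc.IH Suc.prems(2) by (metis Ck.simps(2))
qed

lemma partial_derivative_const [simp]: "partial_derivative j (\<lambda>_. c) x = 0"
  by (simp add: partial_derivative_eq[OF has_derivative_const])

lemma Ck_const: "Ck k \<Omega> (\<lambda>_. c)"
  by (induction k arbitrary: c) (auto simp: partial_derivative_const[abs_def])

lemma partial_derivative_add:
  assumes "f differentiable (at x)" "g differentiable (at x)"
  shows "partial_derivative j (\<lambda>x. f x + g x) x = partial_derivative j f x + partial_derivative j g x"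
proof -
  obtain f' g' where "(f has_derivative f') (at x)" "(g has_derivative g') (at x)"
    using assms by (auto simp: differentiable_def)
  then show ?thesis
    using partial_derivative_eq[OF has_derivative_add] by (simp add: partial_derivative_eq)
qed

lemma partial_derivative_mult:
  fixes f g :: "real^'p::finite \<Rightarrow> real"
  assumes "f differentiable (at x)" "g differentiable (at x)"
  shows "partial_derivative j (\<lambda>x. f x * g x) x
    = f x * partial_derivative j g x + partial_derivative j f x * g x"
proof -
  obtain f' g' where "(f has_derivative f') (at x)" "(g has_derivative g') (at x)"
    using assms by (auto simp: differentiable_def)
  then show ?thesis
    using partial_derivative_eq[OF has_derivative_mult] by (simp add: partial_derivative_eq)
qed

section \<open>Closure properties, second derivatives and Lipschitz bounds\<close>

context
  fixes \<Omega> :: "(real^'p::finite) set"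
  assumes op: "open \<Omega>"
begin

lemma Ck_add: "Ck k \<Omega> f \<Longrightarrow> Ck k \<Omega> g \<Longrightarrow> Ck k \<Omega> (\<lambda>x. f x + g x)"
proof (induction k arbitrary: f g)
  case (Suc k)
  have "Ck k \<Omega> (partial_derivative j (\<lambda>x. f x + g x))" for j
    by (rule Ck_cong_imp[OF op, where f = "\<lambda>x. partial_derivative j f x + partial_derivative j g x"])
      (use Suc in \<open>auto simp: partial_derivative_add\<close>)
  then show ?case
    using Suc.prems by auto
qed (auto intro: continuous_intros)

lemma Ck_mult: "Ck k \<Omega> f \<Longrightarrow> Ck k \<Omega> g \<Longrightarrow> Ck k \<Omega> (\<lambda>x. f x * g x)"
proof (induction k arbitrary: f g)
  case (Suc k)
  have "Ck k \<Omega> (partial_derivative j (\<lambda>x. f x * g x))" for j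
  proof (rule Ck_cong_imp[OF op, where
        f = "\<lambda>x. f x * partial_derivative j g x + partial_derivative j f x * g x"])
    show "Ck k \<Omega> (\<lambda>x. f x * partial_derivative j g x + partial_derivative j f x * g x)"
      using Suc.prems Ck_SucD[of k \<Omega>] by (intro Ck_add Suc.IH) auto
  qed (use Suc.prems in \<open>auto simp: partial_derivative_mult\<close>)
  then show ?case
    using Suc.prems by auto
qed (auto intro: continuous_intros)

lemma Ck_sum: "(\<And>a. a \<in> A \<Longrightarrow> Ck k \<Omega> (f a)) \<Longrightarrow> Ck k \<Omega> (\<lambda>x. \<Sum>a\<in>A. f a x)"
  by (induction A rule: infinite_finite_induct) (auto intro: Ck_const Ck_add)

lemma Ck_diff:
  assumes "Ck k \<Omega> f" "Ck k \<Omega> g"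
  shows "Ck k \<Omega> (\<lambda>x. f x - g x)"
  using Ck_add[OF assms(1) Ck_mult[OF Ck_const[of k \<Omega> "- 1"] assms(2)]] by simp

lemma Ck_nth: "Ck k \<Omega> (\<lambda>x. x $ i)"
proof (cases k)
  case (Suc m)
  have d: "((\<lambda>x. x $ i) has_derivative (\<lambda>h. h $ i)) (at x)" for x :: "real^'p"
    by (rule bounded_linear_imp_has_derivative[OF bounded_linear_vec_nth])
  then have "(\<lambda>x::real^'p. x $ i) differentiable (at x)" for x
    unfolding differentiable_def by blast
  moreover have "partial_derivative j (\<lambda>x. x $ i) = (\<lambda>_::real^'p. axis j 1 $ i)" for j
    using partial_derivative_eq[OF d] by auto
  ultimately show ?thesis
    by (simp add: Suc Ck_const)
qed (auto intro: continuous_intros)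

lemma Ck_vf_apply:
  assumes "Ck (Suc k) \<Omega> f" "\<And>j. Ck k \<Omega> (\<lambda>x. X x $ j)"
  shows "Ck k \<Omega> (vf_apply X f)"
proof (rule Ck_cong_imp[OF op, where f = "\<lambda>x. \<Sum>j\<in>UNIV. X x $ j * partial_derivative j f x"])
  show "Ck k \<Omega> (\<lambda>x. \<Sum>j\<in>UNIV. X x $ j * partial_derivative j f x)"
    using assms by (intro Ck_sum Ck_mult) auto
qed (use assms(1) in \<open>simp add: vf_apply_eq_sum\<close>)

lemma Ck_lie_bracket:
  assumes "\<And>j. Ck (Suc k) \<Omega> (\<lambda>x. X x $ j)" "\<And>j. Ck (Suc k) \<Omega> (\<lambda>x. Y x $ j)"
  shows "Ck k \<Omega> (\<lambda>x. lie_bracket X Y x $ j)"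
  unfolding lie_bracket_def using assms
  by (auto intro!: Ck_diff Ck_vf_apply dest: Ck_SucD simp del: Ck.simps)

text \<open>Schwarz's argument: the mean value theorem is applied along i to the increment in
  direction j, and then once more along j. The second difference is h^2 times a mixed derivative at
  a nearby point.\<close>

lemma mixed_difference_quotient:
  assumes "Ck 2 \<Omega> f" "x \<in> \<Omega>" "\<epsilon> > 0"
  shows "\<forall>\<^sub>F h in at_right 0.
    \<bar>(f (x + h *\<^sub>R axis i 1 + h *\<^sub>R axis j 1) - f (x + h *\<^sub>R axis i 1) - f (x + h *\<^sub>R axis j 1) + f x) / h\<^sup>2
      - partial_derivative j (partial_derivative i f) x\<bar> < \<epsilon>"
proof -
  let ?u = "axis i 1 :: real^'p" and ?v = "axis j 1 :: real^'p"
  let ?D = "partial_derivative j (partial_derivative i f)"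
  have C1: "f differentiable (at y)" "partial_derivative i f differentiable (at y)" if "y \<in> \<Omega>" for y
    using assms(1) that by (auto simp: numeral_2_eq_2)
  have "continuous_on \<Omega> ?D"
    using assms(1) by (auto simp: numeral_2_eq_2)
  then have "isCont ?D x"
    using op assms(2) continuous_on_eq_continuous_at by blast
  then obtain d1 where d1: "d1 > 0" "\<And>y. dist y x < d1 \<Longrightarrow> \<bar>?D y - ?D x\<bar> < \<epsilon>"
    using \<open>\<epsilon> > 0\<close> unfolding continuous_at_eps_delta dist_real_def by blast
  obtain d2 where d2: "d2 > 0" "ball x d2 \<subseteq> \<Omega>"
    using op assms(2) openE by blast
  \<comment> \<open>The intermediate point is displaced by at most
    \<open>\<bar>s\<bar> + \<bar>r\<bar>\<close>, hence the factor 1/2.\<close>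
  define d where "d = min d1 d2 / 2"
  have "d > 0" using d1 d2 by (simp add: d_def)
  have near: "dist (x + s *\<^sub>R ?u + r *\<^sub>R ?v) x < min d1 d2" if "\<bar>s\<bar> < d" "\<bar>r\<bar> < d" for s r
  proof -
    have "dist (x + s *\<^sub>R ?u + r *\<^sub>R ?v) x = norm (s *\<^sub>R ?u + r *\<^sub>R ?v)"
      by (simp add: dist_norm algebra_simps)
    also have "\<dots> \<le> \<bar>s\<bar> + \<bar>r\<bar>"
      using norm_triangle_ineq[of "s *\<^sub>R ?u" "r *\<^sub>R ?v"] by simp
    finally show ?thesis using that by (simp add: d_def)
  qed
  have inS: "x + s *\<^sub>R ?u + r *\<^sub>R ?v \<in> \<Omega>" if "\<bar>s\<bar> < d" "\<bar>r\<bar> < d" for s r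
    using near[OF that] d2(2) by (auto simp: dist_commute subset_iff)
  have line: "((\<lambda>s. g (a + s *\<^sub>R axis k 1)) has_real_derivative partial_derivative k g (a + s *\<^sub>R axis k 1)) (at s)"
    if g: "g differentiable (at (a + s *\<^sub>R axis k 1))" for g :: "real^'p \<Rightarrow> real" and a s k
  proof -
    let ?y = "a + s *\<^sub>R axis k 1"
    obtain g' where g': "(g has_derivative g') (at ?y)"
      using g by (auto simp: differentiable_def)
    have l: "((\<lambda>s. a + s *\<^sub>R axis k 1) has_derivative (\<lambda>h. h *\<^sub>R axis k 1)) (at s)"
      by (auto intro!: derivative_eq_intros)
    have "((\<lambda>s. g (a + s *\<^sub>R axis k 1)) has_derivative (\<lambda>h. g' (h *\<^sub>R axis k 1))) (at s)"
      by (rule has_derivative_compose[OF l g'])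
    moreover have "g' (h *\<^sub>R axis k 1) = partial_derivative k g ?y * h" for h
      using linear_cmul[OF has_derivative_linear[OF g']] by (simp add: partial_derivative_eq[OF g'])
    ultimately show ?thesis
      by (simp add: has_field_derivative_def)
  qed
  have "\<bar>(f (x + h *\<^sub>R ?u + h *\<^sub>R ?v) - f (x + h *\<^sub>R ?u) - f (x + h *\<^sub>R ?v) + f x) / h\<^sup>2 - ?D x\<bar> < \<epsilon>"
    if h: "0 < h" "h < d" for h
  proof -
    define g where "g s = f ((x + h *\<^sub>R ?v) + s *\<^sub>R ?u) - f (x + s *\<^sub>R ?u)" for s
    have "\<exists>s. 0 < s \<and> s < h \<and> g h - g 0
        = (h - 0) * (partial_derivative i f ((x + h *\<^sub>R ?v) + s *\<^sub>R ?u) - partial_derivative i f (x + s *\<^sub>R ?u))"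
    proof (rule MVT2)
      fix s assume s: "0 \<le> s" "s \<le> h"
      have "x + h *\<^sub>R ?v + s *\<^sub>R ?u \<in> \<Omega>" "x + s *\<^sub>R ?u \<in> \<Omega>"
        using inS[of s h] inS[of s 0] s h by (auto simp: add_ac)
      then show "DERIV g s :> partial_derivative i f ((x + h *\<^sub>R ?v) + s *\<^sub>R ?u) - partial_derivative i f (x + s *\<^sub>R ?u)"
        unfolding g_def by (intro DERIV_diff line C1)
    qed (use h in auto)
    then obtain s where s: "0 < s" "s < h" and gs: "g h - g 0
        = h * (partial_derivative i f ((x + s *\<^sub>R ?u) + h *\<^sub>R ?v) - partial_derivative i f (x + s *\<^sub>R ?u))"
      by (auto simp: add_ac)
    have "\<exists>r. 0 < r \<and> r < h \<and> partial_derivative i f ((x + s *\<^sub>R ?u) + h *\<^sub>R ?v) - partial_derivative i f ((x + s *\<^sub>R ?u) + 0 *\<^sub>R ?v)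
        = (h - 0) * ?D ((x + s *\<^sub>R ?u) + r *\<^sub>R ?v)"
    proof (rule MVT2)
      fix r assume r: "0 \<le> r" "r \<le> h"
      show "((\<lambda>r. partial_derivative i f ((x + s *\<^sub>R ?u) + r *\<^sub>R ?v)) has_real_derivative ?D ((x + s *\<^sub>R ?u) + r *\<^sub>R ?v)) (at r)"
        using r s h by (intro line C1 inS) auto
    qed (use h in auto)
    then obtain r where r: "0 < r" "r < h" and
      "partial_derivative i f ((x + s *\<^sub>R ?u) + h *\<^sub>R ?v) - partial_derivative i f (x + s *\<^sub>R ?u)
        = h * ?D (x + s *\<^sub>R ?u + r *\<^sub>R ?v)"
      by auto
    with gs have "g h - g 0 = h\<^sup>2 * ?D (x + s *\<^sub>R ?u + r *\<^sub>R ?v)"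
      by (simp add: power2_eq_square)
    moreover have "g h - g 0 = f (x + h *\<^sub>R ?u + h *\<^sub>R ?v) - f (x + h *\<^sub>R ?u) - f (x + h *\<^sub>R ?v) + f x"
      by (simp add: g_def add_ac)
    ultimately show ?thesis
      using d1(2)[of "x + s *\<^sub>R ?u + r *\<^sub>R ?v"] near[of s r] h s r by simp
  qed
  then show ?thesis
    using \<open>d > 0\<close> unfolding eventually_at_right_field by blast
qed

text \<open>The second difference quotient is symmetric in i and j, while its limit is one mixed
  derivative or the other according to the order of the two mean value steps.\<close>

lemma partial_derivative_commute:
  assumes "Ck 2 \<Omega> f" "x \<in> \<Omega>"
  shows "partial_derivative i (partial_derivative j f) x = partial_derivative j (partial_derivative i f) x"
proof -
  let ?Q = "\<lambda>h. (f (x + h *\<^sub>R axis i 1 + h *\<^sub>R axis j 1) - f (x + h *\<^sub>R axis i 1) - f (x + h *\<^sub>R axis j 1) + f x) / h\<^sup>2"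
  have "(?Q \<longlongrightarrow> partial_derivative j (partial_derivative i f) x) (at_right 0)"
    using mixed_difference_quotient[OF assms, of _ i j] by (auto simp: tendsto_iff dist_real_def)
  moreover have "(?Q \<longlongrightarrow> partial_derivative i (partial_derivative j f) x) (at_right 0)"
    using mixed_difference_quotient[OF assms, of _ j i] by (auto simp: tendsto_iff dist_real_def algebra_simps)
  ultimately show ?thesis
    using tendsto_unique trivial_limit_at_right_real by blast
qed

text \<open>The symmetry of second derivatives is derived from C^2 here, whereas
  \<open>vf_apply_lie_bracket\<close> takes it as a hypothesis. When both compositions are expanded
  in coordinates, the terms with second derivatives of f cancel.\<close>

lemma vf_apply_lie_bracket_Ck:
  assumes f: "Ck 2 \<Omega> f" and X: "\<And>j. Ck 1 \<Omega> (\<lambda>x. X x $ j)" and Y: "\<And>j. Ck 1 \<Omega> (\<lambda>x. Y x $ j)"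
    and x: "x \<in> \<Omega>"
  shows "vf_apply (lie_bracket X Y) f x = vf_apply X (vf_apply Y f) x - vf_apply Y (vf_apply X f) x"
proof -
  have C1: "f differentiable (at y)" "partial_derivative i f differentiable (at y)" if "y \<in> \<Omega>" for y i
    using f that by (auto simp: numeral_2_eq_2)
  have two: "vf_apply V (vf_apply Z f) x
      = (\<Sum>i\<in>UNIV. \<Sum>j\<in>UNIV. V x $ i * partial_derivative i (\<lambda>y. Z y $ j) x * partial_derivative j f x)
      + (\<Sum>i\<in>UNIV. \<Sum>j\<in>UNIV. V x $ i * Z x $ j * partial_derivative i (partial_derivative j f) x)"
    if V: "\<And>j. Ck 1 \<Omega> (\<lambda>x. V x $ j)" and Z: "\<And>j. Ck 1 \<Omega> (\<lambda>x. Z x $ j)" for V Z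
  proof -
    have Zd: "(\<lambda>y. Z y $ j) differentiable (at x)" for j
      using Z[of j] x by simp
    let ?F = "\<lambda>y. \<Sum>j\<in>UNIV. Z y $ j * partial_derivative j f y"
    \<comment> \<open>Differentiability of the partial sums is proved along with the formula, since
      the sum rule in the induction step asks for it.\<close>
    have pd: "partial_derivative i (\<lambda>y. \<Sum>j\<in>A. Z y $ j * partial_derivative j f y) x
        = (\<Sum>j\<in>A. Z x $ j * partial_derivative i (partial_derivative j f) x
            + partial_derivative i (\<lambda>y. Z y $ j) x * partial_derivative j f x)
        \<and> (\<lambda>y. \<Sum>j\<in>A. Z y $ j * partial_derivative j f y) differentiable (at x)" for i A
    proof (induction A rule: infinite_finite_induct)
      case (insert j A)
      have "(\<lambda>y. Z y $ j * partial_derivative j f y) differentiable (at x)"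
        using Zd C1[OF x] by (intro differentiable_mult)
      then show ?case
        using insert Zd C1[OF x]
        by (simp add: partial_derivative_add partial_derivative_mult differentiable_add)
    qed auto
    have "vf_apply V (vf_apply Z f) x = vf_apply V ?F x"
      unfolding vf_apply_def[of V]
      by (rule arg_cong[where f = "\<lambda>h. h (V x)"], rule frechet_derivative_cong_open[OF op x])
        (simp add: vf_apply_eq_sum C1)
    also have "\<dots> = (\<Sum>i\<in>UNIV. V x $ i * partial_derivative i ?F x)"
      using pd by (simp add: vf_apply_eq_sum)
    finally show ?thesis
      using pd by (simp add: algebra_simps sum.distrib sum_distrib_left)
  qed
  have "(\<Sum>i\<in>UNIV. \<Sum>j\<in>UNIV. X x $ i * Y x $ j * partial_derivative i (partial_derivative j f) x)
    = (\<Sum>i\<in>UNIV. \<Sum>j\<in>UNIV. Y x $ i * X x $ j * partial_derivative i (partial_derivative j f) x)"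
    by (subst sum.swap) (simp add: partial_derivative_commute[OF f x] mult_ac)
  moreover have "vf_apply (lie_bracket X Y) f x
      = (\<Sum>i\<in>UNIV. \<Sum>j\<in>UNIV. X x $ i * partial_derivative i (\<lambda>y. Y y $ j) x * partial_derivative j f x)
      - (\<Sum>i\<in>UNIV. \<Sum>j\<in>UNIV. Y x $ i * partial_derivative i (\<lambda>y. X y $ j) x * partial_derivative j f x)"
  proof -
    have "lie_bracket X Y x $ j = (\<Sum>i\<in>UNIV. X x $ i * partial_derivative i (\<lambda>y. Y y $ j) x)
        - (\<Sum>i\<in>UNIV. Y x $ i * partial_derivative i (\<lambda>y. X y $ j) x)" for j
      using X[of j] Y[of j] x by (simp add: lie_bracket_def vf_apply_eq_sum)
    then show ?thesis
      using C1[OF x]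
      by (subst (1 2) sum.swap) (simp add: vf_apply_eq_sum left_diff_distrib sum_distrib_right sum_subtractf)
  qed
  ultimately show ?thesis
    by (simp add: two[OF X Y] two[OF Y X])
qed

text \<open>Continuous partial derivatives are bounded on the compact ball, and the ball is convex,
  so the mean value inequality applies to each component; the constants of the components are
  added.\<close>

lemma Ck_lipschitz_on_cball:
  assumes C: "\<And>j. Ck 1 \<Omega> (\<lambda>x. X x $ j)" and sub: "cball c R \<subseteq> \<Omega>"
  shows "\<exists>L. L-lipschitz_on (cball c R) (X :: real^'p \<Rightarrow> real^'p)"
proof -
  have diff: "(\<lambda>y. X y $ k) differentiable (at y)" if "y \<in> \<Omega>" for y k
    using C[of k] that by simp
  have "\<exists>b. \<forall>y\<in>cball c R. \<bar>partial_derivative j (\<lambda>y. X y $ k) y\<bar> \<le> b" for j k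
  proof -
    have "continuous_on (cball c R) (partial_derivative j (\<lambda>y. X y $ k))"
      using C[of k] sub by (auto intro: continuous_on_subset)
    then have "bounded (partial_derivative j (\<lambda>y. X y $ k) ` cball c R)"
      by (intro compact_imp_bounded compact_continuous_image) auto
    then show ?thesis
      by (auto simp: bounded_iff)
  qed
  then obtain b where b: "\<And>j k y. y \<in> cball c R \<Longrightarrow> \<bar>partial_derivative j (\<lambda>y. X y $ k) y\<bar> \<le> b j k"
    by metis
  define B where "B k = (\<Sum>j\<in>UNIV. \<bar>b j k\<bar>)" for k
  have comp: "norm (X x $ k - X y $ k) \<le> B k * norm (x - y)" if "x \<in> cball c R" "y \<in> cball c R" for x y k
  proof (rule differentiable_bound[where S = "cball c R" and f' = "\<lambda>y. frechet_derivative (\<lambda>y. X y $ k) (at y)"])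
    fix z assume z: "z \<in> cball c R"
    then show "((\<lambda>y. X y $ k) has_derivative frechet_derivative (\<lambda>y. X y $ k) (at z)) (at z within cball c R)"
      using diff sub by (meson frechet_derivative_works has_derivative_at_withinI subsetD)
    show "onorm (frechet_derivative (\<lambda>y. X y $ k) (at z)) \<le> B k"
    proof (rule onorm_le)
      fix h
      have "frechet_derivative (\<lambda>y. X y $ k) (at z) h = (\<Sum>j\<in>UNIV. h $ j * partial_derivative j (\<lambda>y. X y $ k) z)"
        using vf_apply_eq_sum[OF diff, of z "\<lambda>_. h"] z sub by (auto simp: vf_apply_def)
      also have "norm \<dots> \<le> (\<Sum>j\<in>UNIV. \<bar>b j k\<bar> * norm h)"
      proof (rule sum_norm_le)
        fix j
        have "\<bar>h $ j\<bar> * \<bar>partial_derivative j (\<lambda>y. X y $ k) z\<bar> \<le> norm h * \<bar>b j k\<bar>"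
          using b[OF z, of j k] component_le_norm_cart[of h j] by (intro mult_mono) auto
        then show "norm (h $ j * partial_derivative j (\<lambda>y. X y $ k) z) \<le> \<bar>b j k\<bar> * norm h"
          by (simp add: abs_mult mult.commute)
      qed
      finally show "norm (frechet_derivative (\<lambda>y. X y $ k) (at z) h) \<le> B k * norm h"
        by (simp add: B_def sum_distrib_right)
    qed
  qed (use that in auto)
  have "(\<Sum>k\<in>UNIV. B k)-lipschitz_on (cball c R) X"
  proof (rule lipschitz_onI)
    fix x y assume xy: "x \<in> cball c R" "y \<in> cball c R"
    have "dist (X x) (X y) \<le> (\<Sum>k\<in>UNIV. \<bar>(X x - X y) $ k\<bar>)"
      unfolding dist_norm by (rule norm_le_l1_cart)
    also have "\<dots> \<le> (\<Sum>k\<in>UNIV. B k * norm (x - y))"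
      using comp[OF xy] by (intro sum_mono) simp
    finally show "dist (X x) (X y) \<le> (\<Sum>k\<in>UNIV. B k) * dist x y"
      by (simp add: dist_norm sum_distrib_right)
  qed (auto simp: B_def intro!: sum_nonneg)
  then show ?thesis by blast
qed

end

text \<open>The time \<delta> is uniform over the starting points in the smaller ball. Negative
  times are reduced to positive times for the field -X.\<close>

lemma integral_curve_exists:
  assumes sub: "cball c R \<subseteq> \<Omega>" and lip: "L-lipschitz_on (cball c R) X" and "\<rho> < R'" "R' \<le> R"
  shows "\<exists>\<delta>>0. \<forall>s x. \<bar>s\<bar> < \<delta> \<longrightarrow> x \<in> cball c \<rho> \<longrightarrow>
    (\<exists>\<phi>. integral_curve \<Omega> X s x \<phi> \<and> (\<forall>\<tau>\<in>closed_segment 0 s. \<phi> \<tau> \<in> cball c R'))"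
proof -
  have "L \<ge> 0"
    using lip by (rule lipschitz_on_nonneg)
  have "bounded (X ` cball c R)"
    using lipschitz_on_continuous_on[OF lip] by (intro compact_imp_bounded compact_continuous_image) auto
  then obtain M where M: "M > 0" "\<And>y. y \<in> cball c R \<Longrightarrow> norm (X y) \<le> M"
    by (auto simp: bounded_pos)
  \<comment> \<open>The first bound makes the Picard map a contraction, the second keeps a curve of
    speed at most M inside the ball of radius R'.\<close>
  define \<delta> where "\<delta> = min (1 / (L + 1)) ((R' - \<rho>) / M)"
  have "\<delta> > 0"
    using \<open>L \<ge> 0\<close> M assms by (simp add: \<delta>_def)
  have pos: "\<exists>\<phi>. integral_curve \<Omega> Z T x \<phi> \<and> (\<forall>\<tau>\<in>closed_segment 0 T. \<phi> \<tau> \<in> cball c R')"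
    if Z: "L-lipschitz_on (cball c R) Z" "\<And>y. y \<in> cball c R \<Longrightarrow> norm (Z y) \<le> M"
      and T: "0 \<le> T" "T < \<delta>" and x: "x \<in> cball c \<rho>" for Z T x
  proof -
    have "T * (L + 1) < 1"
      using T(2) \<open>L \<ge> 0\<close> by (simp add: \<delta>_def field_simps)
    then have "T * L < 1"
      using T(1) by (simp add: algebra_simps)
    moreover have le: "\<rho> + T * M \<le> R'"
      using T(2) M(1) by (simp add: \<delta>_def field_simps)
    ultimately obtain \<phi> where \<phi>: "\<phi> 0 = x" "\<And>\<tau>. \<tau> \<in> {0..T} \<Longrightarrow> \<phi> \<tau> \<in> cball c (\<rho> + T * M)"
      "\<And>\<tau>. \<tau> \<in> {0..T} \<Longrightarrow> (\<phi> has_vector_derivative Z (\<phi> \<tau>)) (at \<tau> within {0..T})"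
      using picard_local[OF Z, of x \<rho> T] x T(1) assms(3,4) by auto
    have "\<phi> \<tau> \<in> cball c R'" if "\<tau> \<in> {0..T}" for \<tau>
      using \<phi>(2)[OF that] le by auto
    moreover have "cball c R' \<subseteq> \<Omega>"
      using sub subset_cball[OF assms(4), of c] by blast
    moreover have "closed_segment 0 T = {0..T}"
      using T(1) by (simp add: closed_segment_eq_real_ivl)
    ultimately show ?thesis
      using \<phi> unfolding integral_curve_def by (metis subsetD)
  qed
  have "\<exists>\<phi>. integral_curve \<Omega> X s x \<phi> \<and> (\<forall>\<tau>\<in>closed_segment 0 s. \<phi> \<tau> \<in> cball c R')"
    if s: "\<bar>s\<bar> < \<delta>" and x: "x \<in> cball c \<rho>" for s x
  proof (cases "0 \<le> s")
    case True
    then show ?thesis using pos[OF lip M(2) _ _ x] s by simp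
  next
    case False
    have "L-lipschitz_on (cball c R) (\<lambda>y. - X y)"
      using lip by (simp add: lipschitz_on_def dist_minus)
    then obtain \<phi> where \<phi>: "integral_curve \<Omega> (\<lambda>y. - X y) (- s) x \<phi>"
      "\<forall>\<tau>\<in>closed_segment 0 (- s). \<phi> \<tau> \<in> cball c R'"
      using pos[of "\<lambda>y. - X y" "- s" x] M(2) s x False by auto
    have "- \<tau> \<in> closed_segment 0 (- s)" if "\<tau> \<in> closed_segment 0 s" for \<tau>
      using that by (auto simp: closed_segment_eq_real_ivl split: if_splits)
    then show ?thesis
      using integral_curve_negate[OF \<phi>(1)] \<phi>(2) by auto
  qed
  then show ?thesis
    using \<open>\<delta> > 0\<close> by blast
qed

text \<open>The derivative is a sum of the same form, one term shorter and with the coefficients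
  shifted by one; this matches the passage from f to X_i f in \<open>flow_taylor\<close>.\<close>

lemma has_real_derivative_exp_polynomial:
  "((\<lambda>\<sigma>. \<Sum>k\<le>N. \<sigma> ^ k / fact k * a k) has_real_derivative (\<Sum>k<N. \<sigma> ^ k / fact k * a (Suc k)))
    (at \<sigma> within S)"
proof (induction N)
  case (Suc N)
  have "((\<lambda>\<sigma>. \<sigma> ^ Suc N / fact (Suc N) * a (Suc N)) has_real_derivative
      real (Suc N) * \<sigma> ^ N / fact (Suc N) * a (Suc N)) (at \<sigma> within S)"
    using DERIV_cmult_right[OF DERIV_cdivide[OF DERIV_pow[of "Suc N" \<sigma> S]]] by (simp del: fact_Suc)
  moreover have "real (Suc N) * \<sigma> ^ N / fact (Suc N) = \<sigma> ^ N / fact N"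
    by (simp add: fact_Suc del: of_nat_Suc)
  ultimately have "((\<lambda>\<sigma>. \<sigma> ^ Suc N / fact (Suc N) * a (Suc N)) has_real_derivative
      \<sigma> ^ N / fact N * a (Suc N)) (at \<sigma> within S)"
    by simp
  from DERIV_add[OF Suc this] show ?case
    by (simp only: sum.atMost_Suc sum.lessThan_Suc)
qed simp

section \<open>Taylor expansion along a flow\<close>

text \<open>The weight p_i is also the loss of regularity of the field. The Lipschitz condition is
  stated separately because C^(r - p_i) is mere continuity for \<open>X 0\<close> when
  \<open>r = 2\<close>.\<close>

locale graded_fields =
  fixes \<Omega> :: "(real^'p::finite) set" and X :: "nat \<Rightarrow> real^'p \<Rightarrow> real^'p" and n r :: nat
  assumes open_domain: "open \<Omega>" and Ck_field: "\<And>i j. i \<le> n \<Longrightarrow> Ck (r - weight i) \<Omega> (\<lambda>x. X i x $ j)"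
    and lipschitz_field: "\<And>i c R. i \<le> n \<Longrightarrow> cball c R \<subseteq> \<Omega> \<Longrightarrow> \<exists>L. L-lipschitz_on (cball c R) (X i)"
begin

lemma locally_lipschitz_field: "i \<le> n \<Longrightarrow> locally_lipschitz \<Omega> (X i)"
  unfolding locally_lipschitz_def
  using open_contains_cball[of \<Omega>] open_domain lipschitz_field by meson

definition word_op :: "nat list \<Rightarrow> (real^'p \<Rightarrow> real) \<Rightarrow> real^'p \<Rightarrow> real" where
  "word_op w f = foldr (\<lambda>i. vf_apply (X i)) w f"

lemma word_op_simps [simp]:
  "word_op [] f = f"
  "word_op (i # w) f = vf_apply (X i) (word_op w f)"
  by (simp_all add: word_op_def)

lemma word_op_append: "word_op (u @ v) f = word_op u (word_op v f)"
  by (simp add: word_op_def)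

text \<open>Differentiating f costs one derivative, at most p_i, and the coefficients of X_i are of
  class C^(r - p_i), hence of class C^(m - p_i) because m \<le> r.\<close>

lemma Ck_vf_apply_field:
  assumes "Ck m \<Omega> f" "m \<le> r" "i \<le> n" "weight i \<le> m"
  shows "Ck (m - weight i) \<Omega> (vf_apply (X i) f)"
proof (rule Ck_vf_apply[OF open_domain])
  show "Ck (Suc (m - weight i)) \<Omega> f"
    using assms weight_pos[of i] by (intro Ck_mono[OF assms(1)]) linarith
  show "Ck (m - weight i) \<Omega> (\<lambda>x. X i x $ j)" for j
    using assms by (intro Ck_mono[OF Ck_field]) auto
qed

lemma Ck_word_op:
  assumes "Ck m \<Omega> f" "m \<le> r" "w \<in> words n m"
  shows "Ck (m - mweight w) \<Omega> (word_op w f)"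
  using assms(3)
proof (induction w)
  case (Cons i w)
  then have "Ck (m - mweight w) \<Omega> (word_op w f)"
    by (intro Cons.IH) (auto simp: words_def)
  then have "Ck (m - mweight w - weight i) \<Omega> (vf_apply (X i) (word_op w f))"
    using Cons.prems assms(2) by (intro Ck_vf_apply_field) (auto simp: words_def)
  then show ?case
    by (simp add: diff_diff_eq add.commute)
qed (use assms(1) in simp)

text \<open>The curve constructed in \<open>integral_curve_exists\<close> stays in the ball;
  uniqueness transfers this to every integral curve.\<close>

lemma short_curve_in_cball:
  assumes "i \<le> n" "cball c R \<subseteq> \<Omega>" "\<rho> < R'" "R' \<le> R"
  shows "\<exists>\<delta>>0. \<forall>s x \<phi>. \<bar>s\<bar> < \<delta> \<longrightarrow> x \<in> cball c \<rho> \<longrightarrow> integral_curve \<Omega> (X i) s x \<phi>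
    \<longrightarrow> (\<forall>\<tau>\<in>closed_segment 0 s. \<phi> \<tau> \<in> cball c R')"
proof -
  obtain L where "L-lipschitz_on (cball c R) (X i)"
    using lipschitz_field assms by blast
  from integral_curve_exists[OF assms(2) this assms(3,4)]
  obtain \<delta> where "\<delta> > 0" and \<delta>: "\<And>s x. \<bar>s\<bar> < \<delta> \<Longrightarrow> x \<in> cball c \<rho> \<Longrightarrow>
    \<exists>\<phi>. integral_curve \<Omega> (X i) s x \<phi> \<and> (\<forall>\<tau>\<in>closed_segment 0 s. \<phi> \<tau> \<in> cball c R')"
    by blast
  show ?thesis
  proof (intro exI[of _ \<delta>] conjI allI impI ballI)
    fix s x \<phi> \<tau>
    assume s: "\<bar>s\<bar> < \<delta>" "x \<in> cball c \<rho>" "integral_curve \<Omega> (X i) s x \<phi>" "\<tau> \<in> closed_segment 0 s"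
    then obtain \<psi> where "integral_curve \<Omega> (X i) s x \<psi>" "\<forall>\<tau>\<in>closed_segment 0 s. \<psi> \<tau> \<in> cball c R'"
      using \<delta> by blast
    then show "\<phi> \<tau> \<in> cball c R'"
      using integral_curve_unique[OF locally_lipschitz_field[OF assms(1)] s(3) _ s(4)] s(4) by metis
  qed (fact \<open>\<delta> > 0\<close>)
qed

lemma has_real_derivative_along_curve:
  assumes "integral_curve \<Omega> Y s x \<phi>" "f differentiable (at (\<phi> \<sigma>))" "\<sigma> \<in> closed_segment 0 s"
  shows "((\<lambda>\<sigma>. f (\<phi> \<sigma>)) has_real_derivative vf_apply Y f (\<phi> \<sigma>)) (at \<sigma> within closed_segment 0 s)"
proof -
  have "(f has_derivative frechet_derivative f (at (\<phi> \<sigma>))) (at (\<phi> \<sigma>))"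
    using assms(2) frechet_derivative_works by blast
  then have "((f \<circ> \<phi>) has_vector_derivative frechet_derivative f (at (\<phi> \<sigma>)) (Y (\<phi> \<sigma>))) (at \<sigma> within closed_segment 0 s)"
    using assms(1,3) unfolding integral_curve_def
    by (intro vector_derivative_diff_chain_within) (auto intro: has_derivative_at_withinI)
  then show ?thesis
    by (simp add: o_def vf_apply_def has_real_derivative_iff_has_vector_derivative)
qed

lemma bounded_on_cball:
  assumes "continuous_on \<Omega> g" "cball c R \<subseteq> \<Omega>"
  obtains B where "B > 0" "\<And>y. y \<in> cball c R \<Longrightarrow> norm (g y) \<le> (B :: real)"
proof -
  have "bounded (g ` cball c R)"
    using continuous_on_subset[OF assms] by (intro compact_imp_bounded compact_continuous_image) auto
  then show ?thesis
    using that by (auto simp: bounded_pos)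
qed

text \<open>For p_i \<le> m, the time derivative of the error for f at order m is the error for X_i
  f at order m - p_i, and the mean value bound over a time of at most \<tau>^p_i restores the
  missing power. The scale \<tau> is kept apart from the time s because the induction hypothesis is
  needed at all intermediate times with one and the same \<tau>.\<close>

lemma flow_taylor:
  assumes i: "i \<le> n" and sub: "cball c R \<subseteq> \<Omega>" and "\<rho> < R"
    and "Ck m \<Omega> f" "m \<le> r" "\<epsilon> > 0"
  shows "\<exists>\<delta>>0. \<forall>\<tau> s x \<phi>. 0 < \<tau> \<longrightarrow> \<tau> < \<delta> \<longrightarrow> \<bar>s\<bar> \<le> \<tau> ^ weight i \<longrightarrow> x \<in> cball c \<rho> \<longrightarrow>
      integral_curve \<Omega> (X i) s x \<phi> \<longrightarrow>
      \<bar>f (\<phi> s) - (\<Sum>k\<le>m div weight i. s ^ k / fact k * word_op (replicate k i) f x)\<bar> \<le> \<epsilon> * \<tau> ^ m"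
  using assms(4-)
proof (induction m arbitrary: f rule: less_induct)
  case (less m)
  let ?p = "weight i"
  obtain d0 where d0: "d0 > 0" and stay: "\<And>s x \<phi> \<tau>. \<bar>s\<bar> < d0 \<Longrightarrow> x \<in> cball c \<rho> \<Longrightarrow>
      integral_curve \<Omega> (X i) s x \<phi> \<Longrightarrow> \<tau> \<in> closed_segment 0 s \<Longrightarrow> \<phi> \<tau> \<in> cball c R"
    using short_curve_in_cball[OF i sub \<open>\<rho> < R\<close> order_refl] by blast
  have small: "\<tau> ^ ?p \<le> \<tau>" if "0 < \<tau>" "\<tau> < 1" for \<tau> :: real
    using power_decreasing[of 1 ?p \<tau>] that weight_pos[of i] by (simp add: Suc_le_eq)
  have moves: "\<bar>g (\<phi> s) - g x\<bar> \<le> B * \<bar>s\<bar>"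
    if s: "\<bar>s\<bar> < d0" "x \<in> cball c \<rho>" "integral_curve \<Omega> (X i) s x \<phi>"
      and g: "\<And>y. y \<in> \<Omega> \<Longrightarrow> g differentiable (at y)"
      and B: "\<And>y. y \<in> cball c R \<Longrightarrow> norm (vf_apply (X i) g y) \<le> B" for g s x \<phi> B
  proof -
    have "norm (g (\<phi> s) - g (\<phi> 0)) \<le> B * norm (s - 0)"
    proof (rule field_differentiable_bound)
      show "((\<lambda>\<sigma>. g (\<phi> \<sigma>)) has_real_derivative vf_apply (X i) g (\<phi> \<sigma>)) (at \<sigma> within closed_segment 0 s)"
        if "\<sigma> \<in> closed_segment 0 s" for \<sigma>
        using s that stay[OF s that] sub by (intro has_real_derivative_along_curve g) auto
      show "norm (vf_apply (X i) g (\<phi> \<sigma>)) \<le> B" if "\<sigma> \<in> closed_segment 0 s" for \<sigma>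
        using B stay[OF s that] by blast
    qed auto
    then show ?thesis
      using s(3) by (simp add: integral_curve_def)
  qed
  consider "m = 0" | "0 < m" "m < ?p" | "?p \<le> m" by linarith
  then show ?case
  proof cases
    case 1
    have "uniformly_continuous_on (cball c R) f"
      using less.prems 1 sub by (intro compact_uniformly_continuous continuous_on_subset[OF _ sub]) auto
    then obtain d1 where d1: "d1 > 0"
      "\<And>y z. y \<in> cball c R \<Longrightarrow> z \<in> cball c R \<Longrightarrow> dist z y < d1 \<Longrightarrow> dist (f z) (f y) < \<epsilon>"
      using \<open>\<epsilon> > 0\<close> unfolding uniformly_continuous_on_def by metis
    obtain L where "L-lipschitz_on (cball c R) (X i)"
      using lipschitz_field[OF i sub] by blast
    then have "bounded (X i ` cball c R)"
      using lipschitz_on_continuous_on by (intro compact_imp_bounded compact_continuous_image) auto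
    then obtain B where B: "B > 0" "\<And>y. y \<in> cball c R \<Longrightarrow> norm (X i y) \<le> B"
      by (auto simp: bounded_pos)
    let ?P = "real CARD('p)"
    \<comment> \<open>f is only continuous here, so the displacement is measured by coordinates:
      each moves by at most \<open>B * \<bar>s\<bar>\<close>, and the l1 norm adds up
      \<open>CARD('p)\<close> of them.\<close>
    define \<delta> where "\<delta> = min (min d0 1) (d1 / (B * (?P + 1)))"
    have "\<delta> > 0"
      using d0 d1 B by (simp add: \<delta>_def)
    moreover have "\<bar>f (\<phi> s) - f x\<bar> \<le> \<epsilon>"
      if \<tau>: "0 < \<tau>" "\<tau> < \<delta>" "\<bar>s\<bar> \<le> \<tau> ^ ?p" and s: "x \<in> cball c \<rho>" "integral_curve \<Omega> (X i) s x \<phi>" for \<tau> s x \<phi>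
    proof -
      have st: "\<bar>s\<bar> \<le> \<tau>"
        using small[of \<tau>] \<tau> by (simp add: \<delta>_def)
      then have s0: "\<bar>s\<bar> < d0"
        using \<tau> by (simp add: \<delta>_def)
      have "\<bar>\<phi> s $ j - x $ j\<bar> \<le> B * \<bar>s\<bar>" for j
      proof (rule moves[OF s0 s, of "\<lambda>y. y $ j"])
        show "(\<lambda>y. y $ j) differentiable (at y)" for y :: "real^'p"
          using Ck_nth[OF open_UNIV, of 1 j] by simp
        show "norm (vf_apply (X i) (\<lambda>y. y $ j) y) \<le> B" if "y \<in> cball c R" for y
          using B(2)[OF that] component_le_norm_cart[of "X i y" j]
          by (simp add: vf_apply_component[OF has_derivative_ident])
      qed
      then have "(\<Sum>j\<in>UNIV. \<bar>(\<phi> s - x) $ j\<bar>) \<le> (\<Sum>j\<in>(UNIV::'p set). B * \<bar>s\<bar>)"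
        by (intro sum_mono) simp
      then have "dist (\<phi> s) x \<le> B * ?P * \<bar>s\<bar>"
        using norm_le_l1_cart[of "\<phi> s - x"] by (simp add: dist_norm mult_ac)
      also have "\<dots> \<le> B * (?P + 1) * \<tau>"
        using B(1) st by (intro mult_mono) auto
      also have "\<dots> < d1"
      proof -
        have "0 < B * (?P + 1)"
          using B(1) by simp
        moreover have "\<tau> < d1 / (B * (?P + 1))"
          using \<tau>(2) by (simp add: \<delta>_def)
        ultimately show ?thesis
          by (simp only: pos_less_divide_eq mult.commute)
      qed
      finally have "dist (\<phi> s) x < d1" .
      moreover have "x \<in> cball c R" "\<phi> s \<in> cball c R"
        using s(1) \<open>\<rho> < R\<close> stay[OF s0 s] by auto
      ultimately show ?thesis
        using d1(2) by (fastforce simp: dist_real_def)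
    qed
    ultimately show ?thesis
      using 1 by auto
  next
    case 2
    have "Ck (Suc 0) \<Omega> f"
      using less.prems(1) 2 by (intro Ck_mono[OF less.prems(1)]) auto
    then have "Ck 0 \<Omega> (vf_apply (X i) f)" and fd: "\<And>y. y \<in> \<Omega> \<Longrightarrow> f differentiable (at y)"
      using Ck_mono[OF Ck_field[OF i]] by (blast intro: Ck_vf_apply[OF open_domain] Ck_differentiable)+
    then obtain B where B: "B > 0" "\<And>y. y \<in> cball c R \<Longrightarrow> norm (vf_apply (X i) f y) \<le> B"
      using bounded_on_cball[OF _ sub] Ck.simps(1) by metis
    \<comment> \<open>Only p_0 = 2 leaves room for such an m. The displacement of f is then
      O(\<tau>^2), hence o(\<tau>), and the sum consists of its constant term.\<close>
    have pm: "?p = 2" "m = 1"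
      using 2 by (auto simp: weight_def split: if_splits)
    define \<delta> where "\<delta> = min (min d0 1) (\<epsilon> / B)"
    have "\<delta> > 0"
      using d0 B \<open>\<epsilon> > 0\<close> by (simp add: \<delta>_def)
    moreover have "\<bar>f (\<phi> s) - f x\<bar> \<le> \<epsilon> * \<tau> ^ m"
      if \<tau>: "0 < \<tau>" "\<tau> < \<delta>" "\<bar>s\<bar> \<le> \<tau> ^ ?p" and s: "x \<in> cball c \<rho>" "integral_curve \<Omega> (X i) s x \<phi>" for \<tau> s x \<phi>
    proof -
      have "\<bar>s\<bar> < d0"
        using small[of \<tau>] \<tau> by (simp add: \<delta>_def)
      then have "\<bar>f (\<phi> s) - f x\<bar> \<le> B * \<bar>s\<bar>"
        using s fd B(2) by (rule moves)
      also have "\<dots> \<le> B * \<tau> * \<tau>"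
        using B(1) \<tau> by (simp add: pm power2_eq_square mult.assoc)
      also have "\<dots> \<le> \<epsilon> * \<tau>"
        using \<tau> B(1) by (intro mult_right_mono) (auto simp: \<delta>_def field_simps)
      finally show ?thesis
        by (simp add: pm)
    qed
    ultimately show ?thesis
      using 2 by auto
  next
    case 3
    let ?g = "vf_apply (X i) f"
    define N where "N = (m - ?p) div ?p"
    have N: "m div ?p = Suc N"
      using 3 by (simp add: N_def le_div_geq)
    have "Ck (m - ?p) \<Omega> ?g"
      using less.prems 3 i by (intro Ck_vf_apply_field) auto
    then obtain d1 where d1: "d1 > 0" and IH: "\<And>\<tau> s x \<phi>. 0 < \<tau> \<Longrightarrow> \<tau> < d1 \<Longrightarrow> \<bar>s\<bar> \<le> \<tau> ^ ?p \<Longrightarrow>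
        x \<in> cball c \<rho> \<Longrightarrow> integral_curve \<Omega> (X i) s x \<phi> \<Longrightarrow>
        \<bar>?g (\<phi> s) - (\<Sum>k\<le>N. s ^ k / fact k * word_op (replicate k i) ?g x)\<bar> \<le> \<epsilon> * \<tau> ^ (m - ?p)"
      using less.IH[of "m - ?p" ?g] less.prems 3 weight_pos[of i] unfolding N_def by fastforce
    have fd: "\<And>y. y \<in> \<Omega> \<Longrightarrow> f differentiable (at y)"
      using less.prems(1) less_le_trans[OF weight_pos 3] by (rule Ck_differentiable)
    have "\<bar>f (\<phi> s) - (\<Sum>k\<le>Suc N. s ^ k / fact k * word_op (replicate k i) f x)\<bar> \<le> \<epsilon> * \<tau> ^ m"
      if \<tau>: "0 < \<tau>" "\<tau> < min (min d0 1) d1" "\<bar>s\<bar> \<le> \<tau> ^ ?p"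
        and s: "x \<in> cball c \<rho>" "integral_curve \<Omega> (X i) s x \<phi>" for \<tau> s x \<phi>
    proof -
      have s0: "\<bar>s\<bar> < d0"
        using small[of \<tau>] \<tau> by simp
      let ?S = "closed_segment 0 s"
      let ?h = "\<lambda>\<sigma>. f (\<phi> \<sigma>) - (\<Sum>k\<le>Suc N. \<sigma> ^ k / fact k * word_op (replicate k i) f x)"
      let ?h' = "\<lambda>\<sigma>. ?g (\<phi> \<sigma>) - (\<Sum>k\<le>N. \<sigma> ^ k / fact k * word_op (replicate k i) ?g x)"
      \<comment> \<open>The letter is split off at the inner end of the word, next to f, whereas
        \<open>replicate\<close> splits it off at the outer end.\<close>
      have shift: "word_op (replicate (Suc k) i) f = word_op (replicate k i) ?g" for k
        unfolding replicate_append_same[symmetric] replicate.simps(2) by (simp add: word_op_append)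
      have "norm (?h s - ?h 0) \<le> (\<epsilon> * \<tau> ^ (m - ?p)) * norm (s - 0)"
      proof (rule field_differentiable_bound[where S = ?S and f' = ?h'])
        fix \<sigma> assume \<sigma>: "\<sigma> \<in> ?S"
        show "(?h has_real_derivative ?h' \<sigma>) (at \<sigma> within ?S)"
        proof (rule DERIV_diff)
          show "((\<lambda>\<sigma>. f (\<phi> \<sigma>)) has_real_derivative ?g (\<phi> \<sigma>)) (at \<sigma> within ?S)"
            using \<sigma> s stay[OF s0 s \<sigma>] sub by (intro has_real_derivative_along_curve fd) auto
          show "((\<lambda>\<sigma>. \<Sum>k\<le>Suc N. \<sigma> ^ k / fact k * word_op (replicate k i) f x) has_real_derivative
              (\<Sum>k\<le>N. \<sigma> ^ k / fact k * word_op (replicate k i) ?g x)) (at \<sigma> within ?S)"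
            using has_real_derivative_exp_polynomial[where N = "Suc N" and a = "\<lambda>k. word_op (replicate k i) f x"]
            unfolding shift lessThan_Suc_atMost .
        qed
        have "\<bar>\<sigma>\<bar> \<le> \<tau> ^ ?p"
          using \<sigma> \<tau>(3) by (auto simp: closed_segment_eq_real_ivl split: if_splits)
        then show "norm (?h' \<sigma>) \<le> \<epsilon> * \<tau> ^ (m - ?p)"
          unfolding real_norm_def using \<tau> integral_curve_restrict[OF s(2) \<sigma>] s(1) by (intro IH) auto
      qed auto
      moreover have "?h 0 = 0"
        using s(2) by (simp add: integral_curve_def sum.atMost_Suc_shift del: sum.atMost_Suc replicate.simps(2))
      ultimately have "\<bar>?h s\<bar> \<le> (\<epsilon> * \<tau> ^ (m - ?p)) * \<bar>s\<bar>"
        by (simp only: diff_zero real_norm_def)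
      also have "\<dots> \<le> (\<epsilon> * \<tau> ^ (m - ?p)) * \<tau> ^ ?p"
        using \<tau> less.prems(3) by (intro mult_left_mono) auto
      also have "\<dots> = \<epsilon> * \<tau> ^ m"
        using 3 by (simp add: mult.assoc flip: power_add)
      finally show ?thesis .
    qed
    then show ?thesis
      unfolding N using d0 d1 by (intro exI[of _ "min (min d0 1) d1"]) auto
  qed
qed

end

section \<open>Expansion of pullbacks as formal series\<close>

context graded_fields
begin

definition series_at :: "nat \<Rightarrow> ncs \<Rightarrow> (real^'p \<Rightarrow> real) \<Rightarrow> real \<Rightarrow> real^'p \<Rightarrow> real" where
  "series_at m A f t x = (\<Sum>w\<in>words n m. nccoeff A w * t ^ mweight w * word_op w f x)"

text \<open>\<open>A\<close> is the asymptotic expansion of the pullback along \<open>G t\<close>: the word \<open>w\<close> stands for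
  the operator \<open>t\<^bsup>|w|\<^esup> X\<^sub>w\<close>. The first conjunct makes compositions defined.\<close>
definition expands :: "real^'p \<Rightarrow> real \<Rightarrow> (real \<Rightarrow> real^'p \<rightharpoonup> real^'p) \<Rightarrow> ncs \<Rightarrow> bool" where
  "expands c R G A \<longleftrightarrow>
     (\<forall>\<rho> \<rho>'. \<rho> < \<rho>' \<longrightarrow> \<rho>' < R \<longrightarrow>
        (\<forall>\<^sub>F t in at 0. \<forall>x\<in>cball c \<rho>. \<exists>y\<in>cball c \<rho>'. G t x = Some y)) \<and>
     (\<forall>\<rho> m f \<epsilon>. \<rho> < R \<longrightarrow> m \<le> r \<longrightarrow> Ck m \<Omega> f \<longrightarrow> \<epsilon> > 0 \<longrightarrow>
        (\<forall>\<^sub>F t in at 0. \<forall>x\<in>cball c \<rho>. \<forall>y. G t x = Some y \<longrightarrow>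
          \<bar>f y - series_at m A f t x\<bar> \<le> \<epsilon> * \<bar>t\<bar> ^ m))"

lemma expandsD1:
  "expands c R G A \<Longrightarrow> \<rho> < \<rho>' \<Longrightarrow> \<rho>' < R \<Longrightarrow>
    \<forall>\<^sub>F t in at 0. \<forall>x\<in>cball c \<rho>. \<exists>y\<in>cball c \<rho>'. G t x = Some y"
  by (simp add: expands_def)

lemma expandsD2:
  "expands c R G A \<Longrightarrow> \<rho> < R \<Longrightarrow> m \<le> r \<Longrightarrow> Ck m \<Omega> f \<Longrightarrow> \<epsilon> > 0 \<Longrightarrow>
    \<forall>\<^sub>F t in at 0. \<forall>x\<in>cball c \<rho>. \<forall>y. G t x = Some y \<longrightarrow>
      \<bar>f y - series_at m A f t x\<bar> \<le> \<epsilon> * \<bar>t\<bar> ^ m"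
  by (simp add: expands_def)

lemma series_at_one: "series_at m 1 f t x = f x"
proof -
  have "series_at m 1 f t x = (\<Sum>w\<in>words n m. if w = [] then f x else 0)"
    unfolding series_at_def by (intro sum.cong) (auto simp: nccoeff_one)
  then show ?thesis
    by (simp add: finite_words) (simp add: words_def)
qed

lemma expands_one: "expands c R (\<lambda>t. Some) 1"
  unfolding expands_def series_at_one by (auto intro!: always_eventually)

text \<open>The right factor acts on f first. After a word v the function X_v f has m - |v|
  derivatives left, and this is exactly where the series of A gets truncated.\<close>

lemma series_at_mult:
  "series_at m (A * B) f t x
    = (\<Sum>v\<in>words n m. nccoeff B v * t ^ mweight v * series_at (m - mweight v) A (word_op v f) t x)"
proof -
  let ?g = "\<lambda>u v. nccoeff A u * nccoeff B v * (t ^ mweight (u @ v) * word_op (u @ v) f x)"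
  have "series_at m (A * B) f t x = (\<Sum>u\<in>words n m. \<Sum>v\<in>words n (m - mweight u). ?g u v)"
    unfolding series_at_def using sum_words_mult[of A B "\<lambda>w. t ^ mweight w * word_op w f x" n m]
    by (simp add: mult.assoc)
  also have "\<dots> = (\<Sum>u\<in>words n m. \<Sum>v\<in>{v \<in> words n m. mweight u + mweight v \<le> m}. ?g u v)"
    by (intro sum.cong refl) (auto simp: words_def)
  also have "\<dots> = (\<Sum>v\<in>words n m. \<Sum>u\<in>{u \<in> words n m. mweight u + mweight v \<le> m}. ?g u v)"
    by (intro sum.swap_restrict finite_words)
  also have "\<dots> = (\<Sum>v\<in>words n m. \<Sum>u\<in>words n (m - mweight v). ?g u v)"
    by (intro sum.cong refl) (auto simp: words_def)
  finally show ?thesis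
    by (simp add: series_at_def sum_distrib_left word_op_append power_add mult_ac)
qed

text \<open>The expansion of F is used at the intermediate point z = G(x), hence on a slightly
  larger ball. Each X_v f(z) is then expanded along G to order m - |v|, and the factor t^|v| brings
  the error back to order m. Neither map is differentiated.\<close>

lemma expands_compose:
  assumes G: "expands c R G A" and F: "expands c R F B"
  shows "expands c R (\<lambda>t. F t \<circ>\<^sub>m G t) (A * B)"
  unfolding expands_def
proof (intro conjI allI impI)
  fix \<rho> \<rho>' :: real assume \<rho>: "\<rho> < \<rho>'" "\<rho>' < R"
  have "\<forall>\<^sub>F t in at 0. \<forall>x\<in>cball c \<rho>. \<exists>y\<in>cball c ((\<rho> + \<rho>') / 2). G t x = Some y"
    by (rule expandsD1[OF G]) (use \<rho> in auto)
  moreover have "\<forall>\<^sub>F t in at 0. \<forall>x\<in>cball c ((\<rho> + \<rho>') / 2). \<exists>y\<in>cball c \<rho>'. F t x = Some y"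
    by (rule expandsD1[OF F]) (use \<rho> in auto)
  ultimately show "\<forall>\<^sub>F t in at 0. \<forall>x\<in>cball c \<rho>. \<exists>y\<in>cball c \<rho>'. (F t \<circ>\<^sub>m G t) x = Some y"
    by eventually_elim (fastforce simp: map_comp_Some_iff)
next
  fix \<rho> m f and \<epsilon> :: real
  assume \<rho>: "\<rho> < R" and m: "m \<le> r" and f: "Ck m \<Omega> f" and "\<epsilon> > 0"
  define \<rho>' where "\<rho>' = (\<rho> + R) / 2"
  have \<rho>': "\<rho> < \<rho>'" "\<rho>' < R"
    using \<rho> by (auto simp: \<rho>'_def)
  define S where "S = (\<Sum>v\<in>words n m. \<bar>nccoeff B v\<bar>)"
  have "S \<ge> 0"
    unfolding S_def by (intro sum_nonneg) auto
  \<comment> \<open>Half of \<epsilon> pays for the expansion of f along F; the other half covers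
    the errors of all words v, weighted by the coefficients of B. The 1 in S + 1 avoids division by
    zero.\<close>
  define e where "e = \<epsilon> / (2 * (S + 1))"
  have "e > 0"
    using \<open>S \<ge> 0\<close> \<open>\<epsilon> > 0\<close> by (simp add: e_def)
  have "\<forall>\<^sub>F t in at 0. \<forall>x\<in>cball c \<rho>. \<exists>y\<in>cball c \<rho>'. G t x = Some y"
    by (rule expandsD1[OF G \<rho>'])
  moreover have "\<forall>\<^sub>F t in at 0. \<forall>x\<in>cball c \<rho>'. \<forall>y. F t x = Some y \<longrightarrow>
      \<bar>f y - series_at m B f t x\<bar> \<le> \<epsilon> / 2 * \<bar>t\<bar> ^ m"
    by (rule expandsD2[OF F \<rho>'(2) m f]) (use \<open>\<epsilon> > 0\<close> in simp)
  moreover have "\<forall>\<^sub>F t in at 0. \<forall>v\<in>words n m. \<forall>x\<in>cball c \<rho>. \<forall>y. G t x = Some y \<longrightarrow>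
      \<bar>word_op v f y - series_at (m - mweight v) A (word_op v f) t x\<bar> \<le> e * \<bar>t\<bar> ^ (m - mweight v)"
    using m \<open>e > 0\<close>
    by (intro eventually_ball_finite finite_words ballI expandsD2[OF G \<rho>] Ck_word_op f) auto
  ultimately show "\<forall>\<^sub>F t in at 0. \<forall>x\<in>cball c \<rho>. \<forall>y. (F t \<circ>\<^sub>m G t) x = Some y \<longrightarrow>
      \<bar>f y - series_at m (A * B) f t x\<bar> \<le> \<epsilon> * \<bar>t\<bar> ^ m"
  proof eventually_elim
    case (elim t)
    show ?case
    proof (intro ballI allI impI)
      fix x y assume x: "x \<in> cball c \<rho>" and "(F t \<circ>\<^sub>m G t) x = Some y"
      then obtain z where z: "G t x = Some z" "F t z = Some y"
        by (auto simp: map_comp_Some_iff)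
      then have "z \<in> cball c \<rho>'"
        using elim(1) x by force
      then have 1: "\<bar>f y - series_at m B f t z\<bar> \<le> \<epsilon> / 2 * \<bar>t\<bar> ^ m"
        using elim(2) z by blast
      have "\<bar>series_at m B f t z - series_at m (A * B) f t x\<bar>
        = \<bar>\<Sum>v\<in>words n m. nccoeff B v * t ^ mweight v *
            (word_op v f z - series_at (m - mweight v) A (word_op v f) t x)\<bar>"
        by (simp add: series_at_mult series_at_def[of m B] algebra_simps sum_subtractf)
      also have "\<dots> \<le> (\<Sum>v\<in>words n m. \<bar>nccoeff B v\<bar> * (e * \<bar>t\<bar> ^ m))"
      proof (rule sum_abs[THEN order_trans], rule sum_mono)
        fix v assume v: "v \<in> words n m"
        then have "\<bar>word_op v f z - series_at (m - mweight v) A (word_op v f) t x\<bar> \<le> e * \<bar>t\<bar> ^ (m - mweight v)"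
          using elim(3) x z by blast
        then have "\<bar>t\<bar> ^ mweight v * \<bar>word_op v f z - series_at (m - mweight v) A (word_op v f) t x\<bar>
            \<le> \<bar>t\<bar> ^ mweight v * (e * \<bar>t\<bar> ^ (m - mweight v))"
          by (intro mult_left_mono) auto
        also have "\<dots> = e * \<bar>t\<bar> ^ m"
          using v by (simp add: words_def mult.left_commute flip: power_add)
        finally show "\<bar>nccoeff B v * t ^ mweight v * (word_op v f z - series_at (m - mweight v) A (word_op v f) t x)\<bar>
            \<le> \<bar>nccoeff B v\<bar> * (e * \<bar>t\<bar> ^ m)"
          by (simp add: abs_mult power_abs mult.assoc mult_left_mono)
      qed
      also have "\<dots> = S * e * \<bar>t\<bar> ^ m"
        by (simp add: S_def sum_distrib_right mult.assoc)
      also have "\<dots> \<le> \<epsilon> / 2 * \<bar>t\<bar> ^ m"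
        using \<open>S \<ge> 0\<close> \<open>\<epsilon> > 0\<close> by (intro mult_right_mono) (auto simp: e_def field_simps)
      finally show "\<bar>f y - series_at m (A * B) f t x\<bar> \<le> \<epsilon> * \<bar>t\<bar> ^ m"
        using 1 by linarith
    qed
  qed
qed

text \<open>Only powers of i have nonzero coefficients, and the k-th power has weight at most m iff
  k \<le> m div p_i. The formal exponential thus evaluates to the Taylor polynomial of
  \<open>flow_taylor\<close>.\<close>

lemma series_at_ncexp:
  assumes "i \<le> n"
  shows "series_at m (ncexp s i) f t x
    = (\<Sum>k\<le>m div weight i. (s * t ^ weight i) ^ k / fact k * word_op (replicate k i) f x)"
proof -
  let ?g = "\<lambda>w. nccoeff (ncexp s i) w * t ^ mweight w * word_op w f x"
  have im: "{w \<in> words n m. set w \<subseteq> {i}} = (\<lambda>k. replicate k i) ` {..m div weight i}"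
  proof (intro set_eqI iffI)
    fix w assume w: "w \<in> {w \<in> words n m. set w \<subseteq> {i}}"
    then have eq: "w = replicate (length w) i"
      by (auto intro!: replicate_eqI)
    then have "mweight w = length w * weight i"
      by (metis mweight_replicate)
    then have "length w \<le> m div weight i"
      using w by (simp add: words_def less_eq_div_iff_mult_less_eq)
    then show "w \<in> (\<lambda>k. replicate k i) ` {..m div weight i}"
      using eq by blast
  next
    fix w assume "w \<in> (\<lambda>k. replicate k i) ` {..m div weight i}"
    then show "w \<in> {w \<in> words n m. set w \<subseteq> {i}}"
      using assms by (auto simp: words_def less_eq_div_iff_mult_less_eq)
  qed
  have "series_at m (ncexp s i) f t x = (\<Sum>w\<in>{w \<in> words n m. set w \<subseteq> {i}}. ?g w)"
    unfolding series_at_def by (intro sum.mono_neutral_right) (auto simp: finite_words nccoeff_ncexp)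
  also have "\<dots> = (\<Sum>k\<le>m div weight i. ?g (replicate k i))"
    unfolding im by (subst sum.reindex) (auto simp: inj_on_def dest: arg_cong[where f = length])
  also have "\<dots> = (\<Sum>k\<le>m div weight i. (s * t ^ weight i) ^ k / fact k * word_op (replicate k i) f x)"
    by (intro sum.cong refl) (auto simp: nccoeff_ncexp power_mult_distrib power_mult mult.commute[of _ "weight i"])
  finally show ?thesis .
qed

text \<open>The error bound is \<open>flow_taylor\<close> with \<tau> = \<bar>t\<bar>, which covers
  both signs of t; the bound on s ensures that the running time is at most \<tau>^p_i.\<close>

lemma expands_flow:
  assumes i: "i \<le> n" and sub: "cball c R \<subseteq> \<Omega>" and "\<bar>s\<bar> \<le> 1"
  shows "expands c R (\<lambda>t. vf_exp \<Omega> (s * t ^ weight i) (X i)) (ncexp s i)"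
  unfolding expands_def
proof (intro conjI allI impI)
  note some = vf_exp_eq_Some[OF locally_lipschitz_field[OF i]]
  fix \<rho> \<rho>' :: real assume \<rho>: "\<rho> < \<rho>'" "\<rho>' < R"
  obtain L where "L-lipschitz_on (cball c R) (X i)"
    using lipschitz_field[OF i sub] by blast
  then obtain \<delta> where "\<delta> > 0" and \<delta>: "\<And>\<sigma> x. \<bar>\<sigma>\<bar> < \<delta> \<Longrightarrow> x \<in> cball c \<rho> \<Longrightarrow>
    \<exists>\<phi>. integral_curve \<Omega> (X i) \<sigma> x \<phi> \<and> (\<forall>\<tau>\<in>closed_segment 0 \<sigma>. \<phi> \<tau> \<in> cball c \<rho>')"
    using integral_curve_exists[OF sub _ \<rho>(1)] \<rho>(2) by (meson less_imp_le)
  have "((\<lambda>t. s * t ^ weight i) \<longlongrightarrow> s * 0 ^ weight i) (at 0)"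
    by (intro tendsto_intros)
  then have "\<forall>\<^sub>F t in at 0. \<bar>s * t ^ weight i\<bar> < \<delta>"
    using \<open>\<delta> > 0\<close> by (simp add: tendsto_iff dist_real_def weight_def split: if_splits)
  then show "\<forall>\<^sub>F t in at 0. \<forall>x\<in>cball c \<rho>. \<exists>y\<in>cball c \<rho>'. vf_exp \<Omega> (s * t ^ weight i) (X i) x = Some y"
  proof eventually_elim
    case (elim t)
    show ?case
    proof
      fix x assume "x \<in> cball c \<rho>"
      then obtain \<phi> where \<phi>: "integral_curve \<Omega> (X i) (s * t ^ weight i) x \<phi>"
        "\<forall>\<tau>\<in>closed_segment 0 (s * t ^ weight i). \<phi> \<tau> \<in> cball c \<rho>'"
        using \<delta>[OF elim] by blast
      then show "\<exists>y\<in>cball c \<rho>'. vf_exp \<Omega> (s * t ^ weight i) (X i) x = Some y"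
        unfolding some by (intro bexI[of _ "\<phi> (s * t ^ weight i)"]) auto
    qed
  qed
next
  note some = vf_exp_eq_Some[OF locally_lipschitz_field[OF i]]
  fix \<rho> m f and \<epsilon> :: real
  assume \<rho>: "\<rho> < R" and m: "m \<le> r" and f: "Ck m \<Omega> f" and "\<epsilon> > 0"
  from flow_taylor[OF i sub \<rho> f m \<open>\<epsilon> > 0\<close>]
  obtain \<delta> where "\<delta> > 0" and \<delta>: "\<And>\<tau> \<sigma> x \<phi>. 0 < \<tau> \<Longrightarrow> \<tau> < \<delta> \<Longrightarrow> \<bar>\<sigma>\<bar> \<le> \<tau> ^ weight i \<Longrightarrow> x \<in> cball c \<rho> \<Longrightarrow>
      integral_curve \<Omega> (X i) \<sigma> x \<phi> \<Longrightarrow>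
      \<bar>f (\<phi> \<sigma>) - (\<Sum>k\<le>m div weight i. \<sigma> ^ k / fact k * word_op (replicate k i) f x)\<bar> \<le> \<epsilon> * \<tau> ^ m"
    by blast
  show "\<forall>\<^sub>F t in at 0. \<forall>x\<in>cball c \<rho>. \<forall>y. vf_exp \<Omega> (s * t ^ weight i) (X i) x = Some y \<longrightarrow>
      \<bar>f y - series_at m (ncexp s i) f t x\<bar> \<le> \<epsilon> * \<bar>t\<bar> ^ m"
    unfolding eventually_at
  proof (intro exI[of _ \<delta>] conjI ballI impI allI)
    fix t x y assume t: "t \<noteq> 0 \<and> dist t 0 < \<delta>" and x: "x \<in> cball c \<rho>"
      and "vf_exp \<Omega> (s * t ^ weight i) (X i) x = Some y"
    then obtain \<phi> where \<phi>: "integral_curve \<Omega> (X i) (s * t ^ weight i) x \<phi>" "\<phi> (s * t ^ weight i) = y"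
      unfolding some by blast
    have "\<bar>s * t ^ weight i\<bar> \<le> \<bar>t\<bar> ^ weight i"
      using \<open>\<bar>s\<bar> \<le> 1\<close> mult_right_mono[of "\<bar>s\<bar>" 1 "\<bar>t\<bar> ^ weight i"] by (simp add: abs_mult power_abs)
    then show "\<bar>f y - series_at m (ncexp s i) f t x\<bar> \<le> \<epsilon> * \<bar>t\<bar> ^ m"
      using \<delta>[of "\<bar>t\<bar>" "s * t ^ weight i" x \<phi>] t x \<phi> by (simp add: series_at_ncexp[OF i])
  qed (use \<open>\<delta> > 0\<close> in auto)
qed

end

section \<open>The series of a word of flows\<close>

fun word_series :: "(real \<times> nat) list \<Rightarrow> ncs" where
  "word_series [] = 1"
| "word_series ((s, i) # w) = ncexp s i * word_series w"

lemma word_series_append: "word_series (v @ w) = word_series v * word_series w"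
  by (induction v rule: word_series.induct) (auto simp: mult.assoc)

lemma (in graded_fields) expands_flow_word:
  assumes "cball c R \<subseteq> \<Omega>" "\<And>s i. (s, i) \<in> set w \<Longrightarrow> \<bar>s\<bar> \<le> 1 \<and> i \<le> n"
  shows "expands c R (\<lambda>t. flow_word \<Omega> X t w) (word_series w)"
  using assms(2)
proof (induction w rule: word_series.induct)
  case (2 s i w)
  then show ?case
    using assms(1) by (auto intro!: expands_compose expands_flow)
qed (simp add: expands_one)

lemma word_series_inv_word_right: "word_series w * word_series (inv_word w) = 1"
proof (induction w rule: word_series.induct)
  case (2 s i w)
  have "word_series ((s, i) # w) * word_series (inv_word ((s, i) # w))
    = ncexp s i * (word_series w * word_series (inv_word w)) * ncexp (- s) i"
    by (simp add: word_series_append mult.assoc)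
  then show ?case
    by (simp add: 2 ncexp_mult ncexp_0)
qed simp

section \<open>The leading term of a commutator\<close>

text \<open>The formal X_[I], built by the recursion of \<open>iterated_bracket\<close>;
  \<open>series_at_bracket_series\<close> matches the two once regularity is at hand.\<close>

fun bracket_series :: "nat list \<Rightarrow> ncs" where
  "bracket_series [] = 0"
| "bracket_series [i] = ncvar i"
| "bracket_series (i # j # J) =
     ncvar i * bracket_series (j # J) - bracket_series (j # J) * ncvar i"

lemma vanish_below_ncvar: "vanish_below (weight i) (ncvar i)"
  by (auto simp: vanish_below_def nccoeff_ncvar)

lemma vanish_below_bracket_series: "vanish_below (mweight I) (bracket_series I)"
proof (induction I rule: bracket_series.induct)
  case (3 i j J)
  then show ?case
    by (auto intro!: vanish_below_diff vanish_below_mult[OF vanish_below_ncvar]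
        vanish_below_mult[OF _ vanish_below_ncvar])
qed (auto simp: vanish_below_ncvar vanish_below_0)

lemma vanish_below_inverse:
  assumes "A * A' = 1" "vanish_below m (A - 1)"
  shows "vanish_below m (A' - 1)"
proof -
  have "A' - 1 = - ((A - 1) * A')"
    by (simp add: left_diff_distrib assms(1))
  then show ?thesis
    using vanish_below_uminus[OF vanish_below_mult[OF assms(2) vanish_below_0]] by simp
qed

text \<open>Since A e^x e^(-x) A^(-1) = 1, the group commutator is exactly 1 + C e^(-x) A^(-1) with
  C = e^x A - A e^x. As C has weight at least |I|, the factor after it counts as 1 at leading order,
  and C itself reduces to [x, b].\<close>

lemma leading_term_comm_word:
  assumes "I \<noteq> []"
  shows "vanish_below (Suc (mweight I)) (word_series (comm_word I) - 1 - bracket_series I)"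
  using assms
proof (induction I rule: comm_word.induct)
  case (2 i)
  then show ?case by (simp add: ncexp_linear_part)
next
  case (3 i j J)
  define A where "A = word_series (comm_word (j # J))"
  define A' where "A' = word_series (inv_word (comm_word (j # J)))"
  define b where "b = bracket_series (j # J)"
  define m where "m = mweight (j # J)"
  let ?e = "ncexp 1 i" and ?e' = "ncexp (- 1) i" and ?x = "ncvar i" and ?p = "weight i"
  have AA': "A * A' = 1"
    by (simp add: A_def A'_def word_series_inv_word_right)
  have ee': "?e * ?e' = 1"
    by (simp add: ncexp_mult ncexp_0)
  have v: "vanish_below (Suc m) (A - 1 - b)"
    using 3 by (simp add: A_def b_def m_def)
  have b: "vanish_below m b"
    unfolding m_def b_def by (rule vanish_below_bracket_series)
  have A1: "vanish_below m (A - 1)"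
    using vanish_below_add[OF vanish_below_mono[OF v] b] by simp
  have m_pos: "1 \<le> m"
    by (simp add: m_def weight_def)
  note u = ncexp_linear_part[of i] and x = vanish_below_ncvar[of i]
  have e1: "vanish_below ?p (?e - 1)"
    using vanish_below_add[OF vanish_below_mono[OF u] x] by simp
  have w: "vanish_below 1 (?e' * A' - 1)"
  proof -
    have "?e' * A' - 1 = (?e' - 1) * A' + (A' - 1)"
      by (simp add: left_diff_distrib)
    moreover have "vanish_below 1 (?e' - 1)"
      using vanish_below_mono[OF vanish_below_inverse[OF ee' e1]] by (simp add: Suc_le_eq)
    moreover have "vanish_below 1 (A' - 1)"
      using vanish_below_mono[OF vanish_below_inverse[OF AA' A1] m_pos] .
    ultimately show ?thesis
      by (metis vanish_below_add vanish_below_mult vanish_below_0 add.right_neutral order_refl)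
  qed
  \<comment> \<open>Subtracting 1 from both factors does not change their commutator, but makes them
    vanish at low weight.\<close>
  define C where "C = (?e - 1) * (A - 1) - (A - 1) * (?e - 1)"
  have "word_series (comm_word (i # j # J)) = ?e * A * ?e' * A'"
    by (simp add: word_series_append A_def A'_def mult.assoc)
  moreover have "?e * A = A * ?e + C"
    by (simp add: C_def algebra_simps)
  moreover have "A * ?e * ?e' * A' = 1"
    using AA' ee' by (metis mult.assoc mult.right_neutral)
  ultimately have "word_series (comm_word (i # j # J)) = 1 + C * (?e' * A')"
    by (simp add: distrib_right mult.assoc)
  \<comment> \<open>Each group of terms has a surplus unit of weight, which comes from e^(-x) A^(-1)
    - 1, from e^x - 1 - x and from A - 1 - b respectively.\<close>
  then have "word_series (comm_word (i # j # J)) - 1 - bracket_series (i # j # J)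
    = C * (?e' * A' - 1)
      + ((?e - 1 - ?x) * (A - 1) - (A - 1) * (?e - 1 - ?x))
      + (?x * (A - 1 - b) - (A - 1 - b) * ?x)"
    by (simp add: C_def b_def[symmetric] algebra_simps)
  moreover have "vanish_below (?p + m) C"
    unfolding C_def
    by (intro vanish_below_diff vanish_below_mult[OF e1 A1] vanish_below_mult[OF A1 e1]) auto
  ultimately have "vanish_below (Suc (?p + m))
    (word_series (comm_word (i # j # J)) - 1 - bracket_series (i # j # J))"
    by (auto intro!: vanish_below_add vanish_below_diff vanish_below_mult[OF _ w]
        vanish_below_mult[OF u A1] vanish_below_mult[OF A1 u]
        vanish_below_mult[OF x v] vanish_below_mult[OF v x])
  then show ?case
    by (simp add: m_def)
qed simp

text \<open>From A A' = 1 follows the exact identity A' - 1 + b = -(A - 1 - b) A' - b (A' - 1), and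
  both terms on the right start above the weight of I.\<close>

lemma leading_term_inv_comm_word:
  assumes "I \<noteq> []"
  shows "vanish_below (Suc (mweight I)) (word_series (inv_word (comm_word I)) - 1 + bracket_series I)"
proof -
  define A where "A = word_series (comm_word I)"
  define A' where "A' = word_series (inv_word (comm_word I))"
  let ?b = "bracket_series I" and ?m = "mweight I"
  have AA': "A * A' = 1"
    by (simp add: A_def A'_def word_series_inv_word_right)
  have v: "vanish_below (Suc ?m) (A - 1 - ?b)"
    unfolding A_def by (rule leading_term_comm_word[OF assms])
  note b = vanish_below_bracket_series[of I]
  have "vanish_below ?m (A - 1)"
    using vanish_below_add[OF vanish_below_mono[OF v] b] by simp
  moreover have "1 \<le> ?m"
    using assms weight_pos by (cases I) (auto simp: Suc_le_eq)
  ultimately have A'1: "vanish_below 1 (A' - 1)"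
    using vanish_below_inverse[OF AA'] vanish_below_mono by blast
  have "vanish_below (Suc ?m) (- ((A - 1 - ?b) * A') - ?b * (A' - 1))"
    by (intro vanish_below_diff vanish_below_uminus vanish_below_mult[OF v vanish_below_0]
        vanish_below_mult[OF b A'1]) simp_all
  moreover have "- ((A - 1 - ?b) * A') - ?b * (A' - 1) = A' - 1 + ?b"
    by (simp add: algebra_simps AA')
  ultimately show ?thesis
    by (simp add: A'_def)
qed

section \<open>From formal brackets to brackets of vector fields\<close>

lemma vf_apply_sum:
  assumes "\<And>a. a \<in> A \<Longrightarrow> g a differentiable (at x)"
  shows "vf_apply Y (\<lambda>x. \<Sum>a\<in>A. c a * g a x) x = (\<Sum>a\<in>A. c a * vf_apply Y (g a) x)"
proof -
  have "((\<lambda>x. \<Sum>a\<in>A. c a * g a x) has_derivative (\<lambda>h. \<Sum>a\<in>A. c a * frechet_derivative (g a) (at x) h)) (at x)"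
    using assms frechet_derivative_works by (intro has_derivative_sum has_derivative_mult_right) blast
  from frechet_derivative_at[OF this, symmetric] show ?thesis
    by (simp add: vf_apply_def)
qed

text \<open>The bracket series is homogeneous, which is stronger than
  \<open>vanish_below_bracket_series\<close>: its evaluation does not depend on the truncation order
  once this reaches |I|.\<close>

lemma nccoeff_bracket_series_eq_0:
  "mweight w \<noteq> mweight I \<Longrightarrow> nccoeff (bracket_series I) w = 0"
proof (induction I arbitrary: w rule: bracket_series.induct)
  case (3 i j J)
  have *: "nccoeff (ncvar i) (take k w) * nccoeff (bracket_series (j # J)) (drop k w) = 0"
    "nccoeff (bracket_series (j # J)) (take k w) * nccoeff (ncvar i) (drop k w) = 0" for k
  proof -
    have "mweight (take k w) + mweight (drop k w) \<noteq> weight i + mweight (j # J)"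
      using 3(3) by (metis append_take_drop_id mweight_append mweight_Cons)
    then show "nccoeff (ncvar i) (take k w) * nccoeff (bracket_series (j # J)) (drop k w) = 0"
      "nccoeff (bracket_series (j # J)) (take k w) * nccoeff (ncvar i) (drop k w) = 0"
      using 3(1)[of "drop k w"] 3(2)[of "take k w"] by (auto simp: nccoeff_ncvar)
  qed
  show ?case
    by (simp only: bracket_series.simps nccoeff_diff nccoeff_mult * sum.neutral_const diff_zero)
qed (auto simp: nccoeff_ncvar)

lemma mem_inv_word: "(s, i) \<in> set (inv_word w) \<longleftrightarrow> (- s, i) \<in> set w"
  by (force simp: inv_word_def)

lemma comm_word_letters: "(s, i) \<in> set (comm_word I) \<Longrightarrow> \<bar>s\<bar> = 1 \<and> i \<in> set I"
proof (induction I arbitrary: s i rule: comm_word.induct)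
  case (3 k j J)
  then consider "s = 1" "i = k" | "s = - 1" "i = k"
    | "(s, i) \<in> set (comm_word (j # J))" | "(- s, i) \<in> set (comm_word (j # J))"
    by (auto simp: mem_inv_word)
  then show ?case
    by cases (use "3.IH" in fastforce)+
qed auto

lemma inv_comm_word_letters: "(s, i) \<in> set (inv_word (comm_word I)) \<Longrightarrow> \<bar>s\<bar> = 1 \<and> i \<in> set I"
  using comm_word_letters[of "- s" i I] by (simp add: mem_inv_word)

context graded_fields
begin

lemma series_at_ncvar:
  assumes "i \<le> n" "weight i \<le> m"
  shows "series_at m (ncvar i) f 1 x = vf_apply (X i) f x"
proof -
  have "series_at m (ncvar i) f 1 x = (\<Sum>w\<in>words n m. if w = [i] then vf_apply (X i) f x else 0)"
    unfolding series_at_def by (intro sum.cong) (auto simp: nccoeff_ncvar)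
  then show ?thesis
    using assms by (simp add: finite_words) (simp add: words_def)
qed

text \<open>A bracket loses one derivative while the weight grows by p_i \<ge> 1, so the count r -
  |I| is never exceeded.\<close>

lemma Ck_iterated_bracket:
  assumes "I \<noteq> []" "set I \<subseteq> {0..n}" "mweight I \<le> r"
  shows "Ck (r - mweight I) \<Omega> (\<lambda>x. iterated_bracket X I x $ j)"
  using assms
proof (induction I arbitrary: j rule: bracket_series.induct)
  case (2 i)
  then show ?case by (simp add: Ck_field)
next
  case (3 i k J)
  show ?case
    unfolding iterated_bracket.simps
  proof (rule Ck_lie_bracket[OF open_domain])
    have *: "Ck (r - mweight (k # J)) \<Omega> (\<lambda>x. iterated_bracket X (k # J) x $ j)" for j
      using 3 by auto
    show "Ck (Suc (r - mweight (i # k # J))) \<Omega> (\<lambda>x. iterated_bracket X (k # J) x $ j)" for j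
      by (rule Ck_mono[OF *]) (use "3.prems"(3) in \<open>auto simp: weight_def\<close>)
    show "Ck (Suc (r - mweight (i # k # J))) \<Omega> (\<lambda>x. X i x $ j)" for j
      using 3 by (intro Ck_mono[OF Ck_field]) (auto simp: weight_def)
  qed
qed simp

text \<open>The formal commutator becomes a commutator of operators, which
  \<open>vf_apply_lie_bracket_Ck\<close> identifies with the Lie bracket. The class m may exceed the
  weight of I because the induction applies the shorter bracket both to f and to X_i f, of class
  C^(m - p_i).\<close>

lemma series_at_bracket_series:
  assumes "I \<noteq> []" "set I \<subseteq> {0..n}" "mweight I \<le> m" "m \<le> r" "Ck m \<Omega> f" "x \<in> \<Omega>"
  shows "series_at (mweight I) (bracket_series I) f 1 x = vf_apply (iterated_bracket X I) f x"
  using assms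
proof (induction I arbitrary: m f x rule: bracket_series.induct)
  case (2 i)
  then show ?case by (simp add: series_at_ncvar)
next
  case (3 i j J)
  let ?J = "j # J" and ?p = "weight i"
  let ?b = "bracket_series ?J" and ?k = "mweight ?J" and ?Y = "iterated_bracket X (j # J)"
  have J: "?J \<noteq> []" "set ?J \<subseteq> {0..n}" and i: "i \<le> n"
    using 3 by auto
  have le: "?p + ?k \<le> m"
    using 3 by simp
  have pos: "1 \<le> ?p" "1 \<le> ?k"
    by (auto simp: weight_def)
  have Xf: "Ck (m - ?p) \<Omega> (vf_apply (X i) f)"
    using le i 3 by (intro Ck_vf_apply_field) auto
  have 1: "series_at (?p + ?k) (?b * ncvar i) f 1 x = vf_apply ?Y (vf_apply (X i) f) x"
  proof -
    have "series_at (?p + ?k) (?b * ncvar i) f 1 x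
      = (\<Sum>v\<in>words n (?p + ?k). if v = [i] then series_at ?k ?b (vf_apply (X i) f) 1 x else 0)"
      unfolding series_at_mult by (intro sum.cong) (auto simp: nccoeff_ncvar)
    also have "\<dots> = series_at ?k ?b (vf_apply (X i) f) 1 x"
      using i by (simp add: finite_words) (simp add: words_def)
    also have "\<dots> = vf_apply ?Y (vf_apply (X i) f) x"
      by (rule "3.IH"(1)[OF J _ _ Xf]) (use le 3 in auto)
    finally show ?thesis .
  qed
  have 2: "series_at (?p + ?k) (ncvar i * ?b) f 1 x = vf_apply (X i) (vf_apply ?Y f) x"
  proof -
    have "series_at (?p + ?k) (ncvar i * ?b) f 1 x
      = (\<Sum>v\<in>words n (?p + ?k). nccoeff ?b v * series_at (?p + ?k - mweight v) (ncvar i) (word_op v f) 1 x)"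
      unfolding series_at_mult by simp
    \<comment> \<open>By homogeneity the words heavier than the shorter bracket drop out; the
      remaining ones leave at least weight p_i for the letter i.\<close>
    also have "\<dots> = (\<Sum>v\<in>words n ?k. nccoeff ?b v * series_at (?p + ?k - mweight v) (ncvar i) (word_op v f) 1 x)"
      by (rule sum.mono_neutral_right[OF finite_words])
        (auto simp: words_def intro: nccoeff_bracket_series_eq_0)
    also have "\<dots> = (\<Sum>v\<in>words n ?k. nccoeff ?b v * vf_apply (X i) (word_op v f) x)"
      by (intro sum.cong refl arg_cong2[of _ _ _ _ "(*)"] series_at_ncvar i)
        (auto simp: words_def)
    also have "\<dots> = vf_apply (X i) (\<lambda>x. \<Sum>v\<in>words n ?k. nccoeff ?b v * word_op v f x) x"
    proof (rule vf_apply_sum[symmetric])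
      fix v assume v: "v \<in> words n ?k"
      then have "Ck (m - mweight v) \<Omega> (word_op v f)"
        using le 3 by (intro Ck_word_op) (auto simp: words_def)
      then show "word_op v f differentiable (at x)"
        using v le pos \<open>x \<in> \<Omega>\<close> by (intro Ck_differentiable) (auto simp: words_def)
    qed
    \<comment> \<open>X_i differentiates the inner function, so the induction hypothesis is used at
      all points y of the open domain rather than at x alone.\<close>
    also have "\<dots> = vf_apply (X i) (vf_apply ?Y f) x"
      unfolding vf_apply_def[of "X i"]
    proof (rule arg_cong[where f = "\<lambda>h. h (X i x)"], rule frechet_derivative_cong_open[OF open_domain \<open>x \<in> \<Omega>\<close>])
      fix y assume y: "y \<in> \<Omega>"
      show "(\<Sum>v\<in>words n ?k. nccoeff ?b v * word_op v f y) = vf_apply ?Y f y"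
        using "3.IH"(1)[OF J _ \<open>m \<le> r\<close> \<open>Ck m \<Omega> f\<close> y] le by (simp add: series_at_def)
    qed
    finally show ?thesis .
  qed
  \<comment> \<open>The weights of the letter and of the remaining word are both at least 1 and add
    up to at most m \<le> r, so f is at least C^2 and both fields are at least C^1.\<close>
  have "vf_apply (lie_bracket (X i) ?Y) f x = vf_apply (X i) (vf_apply ?Y f) x - vf_apply ?Y (vf_apply (X i) f) x"
  proof (rule vf_apply_lie_bracket_Ck[OF open_domain _ _ _ \<open>x \<in> \<Omega>\<close>])
    show "Ck 2 \<Omega> f"
      using le pos by (intro Ck_mono[OF \<open>Ck m \<Omega> f\<close>]) linarith
    show "Ck 1 \<Omega> (\<lambda>x. X i x $ l)" for l
      using le pos \<open>m \<le> r\<close> by (intro Ck_mono[OF Ck_field[OF i]]) linarith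
    show "Ck 1 \<Omega> (\<lambda>x. ?Y x $ l)" for l
      using le pos \<open>m \<le> r\<close> by (intro Ck_mono[OF Ck_iterated_bracket[OF J]]) linarith+
  qed
  moreover have "series_at (mweight (i # ?J)) (bracket_series (i # ?J)) f 1 x
    = series_at (?p + ?k) (ncvar i * ?b) f 1 x - series_at (?p + ?k) (?b * ncvar i) f 1 x"
    by (simp add: series_at_def left_diff_distrib sum_subtractf)
  ultimately show ?case
    using 1 2 by simp
qed simp

text \<open>By homogeneity every word of the bracket carries the same power of t, which factors out
  and leaves an evaluation at t = 1. The sign \<sigma> is 1 for the commutator and -1 for its
  inverse.\<close>

lemma series_at_leading_term:
  assumes I: "I \<noteq> []" "set I \<subseteq> {0..n}" "mweight I \<le> r" and f: "Ck (mweight I) \<Omega> f" "x \<in> \<Omega>"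
    and A: "\<And>w. mweight w \<le> mweight I \<Longrightarrow> nccoeff A w = nccoeff 1 w + \<sigma> * nccoeff (bracket_series I) w"
  shows "series_at (mweight I) A f t x = f x + t ^ mweight I * (\<sigma> * vf_apply (iterated_bracket X I) f x)"
proof -
  let ?m = "mweight I" and ?b = "bracket_series I"
  have "nccoeff A w * t ^ mweight w * word_op w f x = nccoeff 1 w * t ^ mweight w * word_op w f x
      + t ^ ?m * (\<sigma> * (nccoeff ?b w * 1 ^ mweight w * word_op w f x))" if "w \<in> words n ?m" for w
    using A[of w] that nccoeff_bracket_series_eq_0[of w I]
    by (cases "mweight w = ?m") (auto simp: words_def algebra_simps)
  then have "series_at ?m A f t x = series_at ?m 1 f t x + t ^ ?m * (\<sigma> * series_at ?m ?b f 1 x)"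
    unfolding series_at_def by (simp add: sum.distrib sum_distrib_left)
  then show ?thesis
    using series_at_bracket_series[OF I(1,2) order_refl I(3) f] by (simp add: series_at_one)
qed

text \<open>X_[I] applied to a coordinate function is a component of the field X_[I]. The norm is
  recovered from \<open>CARD('p)\<close> components with an error share of
  \<open>\<epsilon> / CARD('p)\<close> each.\<close>

lemma expands_leading_term:
  assumes G: "expands c R G A" and sub: "cball c R \<subseteq> \<Omega>" and "\<rho> < R" "\<epsilon> > 0"
    and I: "I \<noteq> []" "set I \<subseteq> {0..n}" "mweight I \<le> r"
    and A: "\<And>w. mweight w \<le> mweight I \<Longrightarrow> nccoeff A w = nccoeff 1 w + \<sigma> * nccoeff (bracket_series I) w"
  shows "\<forall>\<^sub>F t in at 0. \<forall>x\<in>cball c \<rho>. \<exists>y. G t x = Some y \<and>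
    norm (y - x - t ^ mweight I *\<^sub>R \<sigma> *\<^sub>R iterated_bracket X I x) \<le> \<epsilon> * \<bar>t\<bar> ^ mweight I"
proof -
  let ?m = "mweight I" and ?V = "iterated_bracket X I" and ?P = "real CARD('p)"
  obtain \<rho>' where "\<rho> < \<rho>'" "\<rho>' < R"
    using dense[OF \<open>\<rho> < R\<close>] by blast
  note expandsD1[OF G this]
  moreover have "\<forall>\<^sub>F t in at 0. \<forall>j\<in>UNIV. \<forall>x\<in>cball c \<rho>. \<forall>y. G t x = Some y \<longrightarrow>
      \<bar>y $ j - series_at ?m A (\<lambda>y. y $ j) t x\<bar> \<le> \<epsilon> / ?P * \<bar>t\<bar> ^ ?m"
    using \<open>\<epsilon> > 0\<close> Ck_nth[OF open_domain]
    by (intro eventually_ball_finite ballI expandsD2[OF G \<open>\<rho> < R\<close> I(3)]) auto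
  ultimately show ?thesis
  proof eventually_elim
    case (elim t)
    show ?case
    proof
      fix x assume x: "x \<in> cball c \<rho>"
      then obtain y where y: "G t x = Some y"
        using elim(1) by blast
      have "x \<in> \<Omega>"
        using x sub \<open>\<rho> < R\<close> by auto
      have "\<bar>(y - x - t ^ ?m *\<^sub>R \<sigma> *\<^sub>R ?V x) $ j\<bar> \<le> \<epsilon> / ?P * \<bar>t\<bar> ^ ?m" for j
      proof -
        have "(y - x - t ^ ?m *\<^sub>R \<sigma> *\<^sub>R ?V x) $ j = y $ j - series_at ?m A (\<lambda>y. y $ j) t x"
          using series_at_leading_term[OF I Ck_nth[OF open_domain, where i = j] \<open>x \<in> \<Omega>\<close> A]
          by (simp add: vf_apply_component[OF has_derivative_ident])
        then show ?thesis
          using elim(2) x y by (simp only: UNIV_I Ball_def)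
      qed
      then have "(\<Sum>j\<in>UNIV. \<bar>(y - x - t ^ ?m *\<^sub>R \<sigma> *\<^sub>R ?V x) $ j\<bar>) \<le> (\<Sum>j\<in>(UNIV::'p set). \<epsilon> / ?P * \<bar>t\<bar> ^ ?m)"
        by (intro sum_mono)
      then have "norm (y - x - t ^ ?m *\<^sub>R \<sigma> *\<^sub>R ?V x) \<le> \<epsilon> * \<bar>t\<bar> ^ ?m"
        using norm_le_l1_cart[of "y - x - t ^ ?m *\<^sub>R \<sigma> *\<^sub>R ?V x"] by simp
      then show "\<exists>y. G t x = Some y \<and> norm (y - x - t ^ ?m *\<^sub>R \<sigma> *\<^sub>R ?V x) \<le> \<epsilon> * \<bar>t\<bar> ^ ?m"
        using y by blast
    qed
  qed
qed

end

section \<open>Uniform remainders\<close>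

lemma uniform_smallo_remainder:
  fixes G :: "real \<Rightarrow> real^'p::finite \<rightharpoonup> real^'p"
  assumes "\<rho> > 0"
    and G: "\<And>\<epsilon>. \<epsilon> > 0 \<Longrightarrow> \<forall>\<^sub>F t in at 0. \<forall>x\<in>cball c \<rho>. \<exists>y. G t x = Some y \<and>
      norm (y - x - t ^ m *\<^sub>R V x) \<le> \<epsilon> * \<bar>t\<bar> ^ m"
  shows "\<exists>f. uniform_smallo (ball c \<rho>) m f \<and>
    (\<forall>\<^sub>F t in at 0. \<forall>x\<in>closure (ball c \<rho>). G t x = Some (x + t ^ m *\<^sub>R V x + f t x))"
proof -
  \<comment> \<open>Where \<open>G t x\<close> is undefined, \<open>the\<close> gives an unspecified
    value; this is harmless because for small t \<noteq> 0 the map is defined on the whole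
    ball.\<close>
  define f where "f t x = the (G t x) - x - t ^ m *\<^sub>R V x" for t x
  have cl: "closure (ball c \<rho>) = cball c \<rho>"
    using \<open>\<rho> > 0\<close> by simp
  have "((\<lambda>t. SUP x\<in>cball c \<rho>. ereal (norm (f t x) / \<bar>t ^ m\<bar>)) \<longlongrightarrow> 0) (at 0)"
  proof (rule order_tendstoI)
    fix a :: ereal assume "a < 0"
    \<comment> \<open>In the extended reals the supremum of an empty set is -\<infinity>; the centre
      c provides the lower bound 0.\<close>
    moreover have "0 \<le> (SUP x\<in>cball c \<rho>. ereal (norm (f t x) / \<bar>t ^ m\<bar>))" for t
      using \<open>\<rho> > 0\<close> by (intro SUP_upper2[of c]) auto
    ultimately show "\<forall>\<^sub>F t in at 0. a < (SUP x\<in>cball c \<rho>. ereal (norm (f t x) / \<bar>t ^ m\<bar>))"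
      by (intro always_eventually allI) (rule less_le_trans)
  next
    fix a :: ereal assume "0 < a"
    then obtain e where e: "0 < ereal e" "ereal e < a"
      using ereal_dense2 by blast
    then have "e > 0" by simp
    have "\<forall>\<^sub>F t in at (0::real). t \<noteq> 0"
      by (simp add: eventually_at_filter)
    with G[OF \<open>e > 0\<close>]
    show "\<forall>\<^sub>F t in at 0. (SUP x\<in>cball c \<rho>. ereal (norm (f t x) / \<bar>t ^ m\<bar>)) < a"
    proof eventually_elim
      case (elim t)
      have "norm (f t x) / \<bar>t ^ m\<bar> \<le> e" if "x \<in> cball c \<rho>" for x
      proof -
        have "norm (f t x) \<le> e * \<bar>t\<bar> ^ m"
          using elim(1) that by (force simp: f_def)
        then show ?thesis
          using elim(2) by (simp add: divide_le_eq power_abs)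
      qed
      then have "(SUP x\<in>cball c \<rho>. ereal (norm (f t x) / \<bar>t ^ m\<bar>)) \<le> ereal e"
        by (intro SUP_least) simp
      then show ?case
        using e(2) by (rule le_less_trans)
    qed
  qed
  then have "uniform_smallo (ball c \<rho>) m f"
    by (simp add: uniform_smallo_def cl)
  moreover have "\<forall>\<^sub>F t in at 0. \<forall>x\<in>closure (ball c \<rho>). G t x = Some (x + t ^ m *\<^sub>R V x + f t x)"
    using G[OF zero_less_one] unfolding cl
    by eventually_elim (force simp: f_def)
  ultimately show ?thesis
    by blast
qed

lemma lipschitz_on_vec:
  fixes Y :: "real^'p::finite \<Rightarrow> real^'p"
  assumes "\<And>j. \<exists>L. L-lipschitz_on S (\<lambda>x. Y x $ j)"
  shows "\<exists>L. L-lipschitz_on S Y"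
proof -
  obtain L where L: "\<And>j. (L j)-lipschitz_on S (\<lambda>x. Y x $ j)"
    using assms by metis
  have "(\<Sum>j\<in>UNIV. L j)-lipschitz_on S Y"
  proof (rule lipschitz_onI)
    fix x y assume xy: "x \<in> S" "y \<in> S"
    have "dist (Y x) (Y y) \<le> (\<Sum>j\<in>UNIV. \<bar>(Y x - Y y) $ j\<bar>)"
      unfolding dist_norm by (rule norm_le_l1_cart)
    also have "\<dots> \<le> (\<Sum>j\<in>UNIV. L j * dist x y)"
      using lipschitz_onD[OF L xy] by (intro sum_mono) (simp add: dist_real_def)
    finally show "dist (Y x) (Y y) \<le> (\<Sum>j\<in>UNIV. L j) * dist x y"
      by (simp add: sum_distrib_right)
  qed (auto intro!: sum_nonneg lipschitz_on_nonneg[OF L])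
  then show ?thesis by blast
qed

text \<open>Unless i = 0 and r = 2, the exponent r - p_i is at least 1 and the fields are C^1, hence
  Lipschitz on balls. The exceptional case is the one in which (B) demands Lipschitz continuity
  explicitly.\<close>

lemma assumptions_B_imp_graded_fields:
  assumes "open \<Omega>" "r \<ge> 2" "assumptions_B \<Omega> r n X"
  shows "graded_fields \<Omega> X n r"
proof
  have pos: "Ck (r - 1) \<Omega> (\<lambda>x. X i x $ j)" if "i \<in> {1..n}" for i j
    using assms(3) that by (auto simp: assumptions_B_def intro: Ck_closure_imp_Ck)
  have zero: "Ck (r - 2) \<Omega> (\<lambda>x. X 0 x $ j)" for j
    using assms(3) by (auto simp: assumptions_B_def intro: Ck_closure_imp_Ck)
  show C: "Ck (r - weight i) \<Omega> (\<lambda>x. X i x $ j)" if "i \<le> n" for i j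
    using pos zero that by (auto simp: weight_def)
  show "\<exists>L. L-lipschitz_on (cball c R) (X i)" if i: "i \<le> n" and sub: "cball c R \<subseteq> \<Omega>" for i c R
  proof (cases "i = 0 \<and> r = 2")
    case True
    then have "\<exists>L. L-lipschitz_on \<Omega> (\<lambda>x. X 0 x $ j)" for j
      using assms(3) by (auto simp: assumptions_B_def)
    then show ?thesis
      using lipschitz_on_vec[of \<Omega> "X 0"] lipschitz_on_subset[OF _ sub] True by blast
  next
    case False
    then have "1 \<le> r - weight i"
      using \<open>r \<ge> 2\<close> by (auto simp: weight_def)
    then show ?thesis
      using Ck_mono[OF C[OF i]] by (intro Ck_lipschitz_on_cball[OF assms(1) _ sub]) blast
  qed
qed (use assms in auto)

theorem theorem4p2:
  fixes \<Omega> :: "(real^'p::finite) set"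
    and X :: "nat \<Rightarrow> real^'p \<Rightarrow> real^'p"
    and n r :: nat
    and x\<^sub>0 :: "real^'p"
    and \<eta> :: "nat list set"
  assumes "open \<Omega>" and "connected \<Omega>" and "bounded \<Omega>"
    and "r \<ge> 2"
    and "assumptions_B \<Omega> r n X"
    and "x\<^sub>0 \<in> \<Omega>"
    and "\<eta> \<subseteq> {I \<in> multiindices n. mweight I \<le> r}"
    and "card \<eta> = CARD('p)"
    and "inj_on (\<lambda>I. iterated_bracket X I x\<^sub>0) \<eta>"
    and "independent ((\<lambda>I. iterated_bracket X I x\<^sub>0) ` \<eta>)"
    and "span ((\<lambda>I. iterated_bracket X I x\<^sub>0) ` \<eta>) = UNIV"
  shows "\<exists>U. open U \<and> x\<^sub>0 \<in> U \<and> closure U \<subseteq> \<Omega> \<and>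
    (\<forall>I\<in>\<eta>.
      (\<exists>f. uniform_smallo U (mweight I) f \<and>
        (\<forall>\<^sub>F t in at 0. \<forall>x\<in>closure U.
          quasi_exp \<Omega> X t I x
            = Some (x + t ^ mweight I *\<^sub>R iterated_bracket X I x + f t x))) \<and>
      (\<exists>f. uniform_smallo U (mweight I) f \<and>
        (\<forall>\<^sub>F t in at 0. \<forall>x\<in>closure U.
          partial_inv (quasi_exp \<Omega> X t I) x
            = Some (x - t ^ mweight I *\<^sub>R iterated_bracket X I x + f t x))))"
proof -
  interpret graded_fields \<Omega> X n r
    by (rule assumptions_B_imp_graded_fields) fact+
  obtain R where R: "R > 0" "cball x\<^sub>0 R \<subseteq> \<Omega>"
    using \<open>open \<Omega>\<close> \<open>x\<^sub>0 \<in> \<Omega>\<close> open_contains_cball by blast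
  \<comment> \<open>The margin between \<rho> and R leaves room for the intermediate points of the
    compositions. \<rho> is fixed before I, so one ball serves all multiindices.\<close>
  define \<rho> where "\<rho> = R / 2"
  have \<rho>: "0 < \<rho>" "\<rho> < R"
    using R by (auto simp: \<rho>_def)
  show ?thesis
  proof (intro exI[of _ "ball x\<^sub>0 \<rho>"] conjI ballI)
    show "closure (ball x\<^sub>0 \<rho>) \<subseteq> \<Omega>"
      using \<rho> R(2) by auto
    fix I assume "I \<in> \<eta>"
    then have I: "I \<noteq> []" "set I \<subseteq> {0..n}" "mweight I \<le> r"
      using assms(7) by (auto simp: multiindices_def)
    have lip: "locally_lipschitz \<Omega> (X i)" if "i \<in> set I" for i
      using that I(2) by (intro locally_lipschitz_field) auto
    have quasi: "quasi_exp \<Omega> X t I = flow_word \<Omega> X t (comm_word I)" for t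
      by (intro quasi_exp_eq_flow_word lip)
    have inv: "partial_inv (quasi_exp \<Omega> X t I) = flow_word \<Omega> X t (inv_word (comm_word I))" for t
      unfolding quasi by (intro partial_inv_flow_word lip) (simp add: snd_comm_word)
    have A: "nccoeff (word_series (comm_word I)) w = nccoeff 1 w + 1 * nccoeff (bracket_series I) w"
      "nccoeff (word_series (inv_word (comm_word I))) w = nccoeff 1 w + - 1 * nccoeff (bracket_series I) w"
      if "mweight w \<le> mweight I" for w
      using that leading_term_comm_word[OF I(1)] leading_term_inv_comm_word[OF I(1)]
      by (auto simp: vanish_below_def less_Suc_eq_le)
    have "expands x\<^sub>0 R (\<lambda>t. flow_word \<Omega> X t (comm_word I)) (word_series (comm_word I))"
      using I(2) by (intro expands_flow_word R) (auto dest: comm_word_letters)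
    from uniform_smallo_remainder[OF \<rho>(1) expands_leading_term[OF this R(2) \<rho>(2) _ I A(1)]]
    show "\<exists>f. uniform_smallo (ball x\<^sub>0 \<rho>) (mweight I) f \<and>
        (\<forall>\<^sub>F t in at 0. \<forall>x\<in>closure (ball x\<^sub>0 \<rho>).
          quasi_exp \<Omega> X t I x = Some (x + t ^ mweight I *\<^sub>R iterated_bracket X I x + f t x))"
      by (simp add: quasi)
    have "expands x\<^sub>0 R (\<lambda>t. flow_word \<Omega> X t (inv_word (comm_word I))) (word_series (inv_word (comm_word I)))"
      using I(2) by (intro expands_flow_word R) (auto dest: inv_comm_word_letters)
    from uniform_smallo_remainder[OF \<rho>(1) expands_leading_term[OF this R(2) \<rho>(2) _ I A(2)]]
    show "\<exists>f. uniform_smallo (ball x\<^sub>0 \<rho>) (mweight I) f \<and>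
        (\<forall>\<^sub>F t in at 0. \<forall>x\<in>closure (ball x\<^sub>0 \<rho>).
          partial_inv (quasi_exp \<Omega> X t I) x = Some (x - t ^ mweight I *\<^sub>R iterated_bracket X I x + f t x))"
      by (simp add: inv)
  qed (use \<rho> in auto)
qed

end
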